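(* Let $k$ be an $F$-finite field of characteristic $p>0$, let $S=k[x_1,\ldots,x_n]$, let $I\subseteq S$ be an ideal, let $R=S/I$, and let $\mathcal{D}\subseteq\mathcal{C}^R$ be a Cartier subalgebra of $R$. If $(R,\mathcal{D})$ is gauge bounded, then $\operatorname{cx}(\mathcal{D})\leq p^n$.
   Context: **Cartier algebras.** For an $F$-finite noetherian commutative ring $R$ of characteristic $p$ (i.e. $F_*R$ is a finite $R$-module, $F$ the Frobenius), the total Cartier algebra is $\mathcal{C}^R=\bigoplus_{e\geq 0}\mathcal{C}^R_e$ with $\mathcal{C}^R_e=\operatorname{Hom}_R(F^e_*R,R)$. It is a graded non-commutative ring with product $\varphi\cdot\psi=\varphi\circ F^a_*\psi$ for $\varphi\in\mathcal{C}^R_a$, $\psi\in\mathcal{C}^R_b$. Each $\mathcal{C}^R_e$ is an $R$-bimodule: $(r\cdot\varphi)(s)=r\varphi(s)$ and $(\varphi\cdot r)(s)=\varphi(rs)$, so $\varphi\cdot r^{p^e}=r\cdot\varphi$. A Cartier subalgebra of $R$ is a graded subring $\mathcal{D}\subseteq\mathcal{C}^R$ with $\mathcal{D}_0=R$ and $\mathcal{D}_e\neq 0$ for some $e>0$. Write $\mathcal{D}_+=\bigoplus_{e\geq 1}\mathcal{D}_e$. **Complexity.** For $e\geq -1$ let $G_e=G_e(\mathcal{D})$ be the subring of $\mathcal{D}$ generated by the elements of degree $\leq e$ (with $G_{-1}=\mathcal{D}_0$), and let $k_e$ be the minimal number of homogeneous generators of $G_e$ as a ring over $\mathcal{D}_0=R$.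 The complexity of $\mathcal{D}$ is $\operatorname{cx}(\mathcal{D})=\inf\{m\in\mathbb{R}_{>0}: k_e-k_{e-1}=\mathcal{O}(m^e)\}$ (as $e\to\infty$), provided the $k_e$ are finite, with $\inf\varnothing=\infty$. **Gauge.** For $d\geq 0$ let $S_d$ be the $k$-subspace of $S$ spanned by all monomials $x_1^{\alpha_1}\cdots x_n^{\alpha_n}$ with $0\leq\alpha_i\leq d$ for all $i$. For $R=S/I$ let $R_d=S_d\cdot 1_R$ (the image of $S_d$ in $R$) for $d\geq 0$, and $R_d=0$ for $d<0$. The gauge $\delta\colon R\to\mathbb{N}\cup\{-\infty\}$ is defined by $\delta(0)=-\infty$ and $\delta(r)=d$ if $r\neq 0$ and $r\in R_d\smallsetminus R_{d-1}$. **Gauge boundedness.** $\mathcal{D}$ (or the pair $(R,\mathcal{D})$) is gauge bounded if there are a set $\{\psi_i\mid\psi_i\in\mathcal{D}_{e_i},\ e_i\geq 1\}$ generating $\mathcal{D}_+$ as a right $R$-module and a constant $K$ such that $\delta(\psi_i(r))\leq\frac{\delta(r)}{p^{e_i}}+K$ for all $i$ and all $r\in R$. *)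

theory Defs
  imports
    "HOL-Algebra.Generated_Rings"
    "HOL-Library.Poly_Mapping"
    "HOL-Library.Extended_Real"
    "HOL-Library.Landau_Symbols"
begin

section \<open>\<open>F\<close>-finite fields\<close>

text \<open>\<open>F\<^sub>*k\<close> is a finite \<open>k\<close>-module, where \<open>c\<close> acts on \<open>F\<^sub>*k\<close> as multiplication by \<open>c\<^sup>p\<close>.\<close>

definition F_finite_field :: "'k::field itself \<Rightarrow> bool" where
  "F_finite_field _ \<longleftrightarrow>
     (\<exists>B::'k set. finite B \<and> (\<forall>x. \<exists>c. x = (\<Sum>b\<in>B. c b ^ CHAR('k) * b)))"


section \<open>Cartier algebras\<close>

text \<open>
  The following definitions are meant for commutative rings \<open>R\<close> of prime characteristic \<open>p\<close>.
  The elements of \<open>Hom\<^sub>R(F\<^sup>e\<^sub>*R, R)\<close> are the additive maps \<open>\<phi>\<close> on \<open>R\<close> with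
  \<open>\<phi>(r\<^bsup>p^e\<^esup> s) = r \<phi>(s)\<close>; as functions they are made extensional (\<open>undefined\<close> outside
  \<open>carrier R\<close>), so that equality of functions is equality of maps.
\<close>

definition cartier_maps :: "('a, 'm) ring_scheme \<Rightarrow> nat \<Rightarrow> nat \<Rightarrow> ('a \<Rightarrow> 'a) set" where
  "cartier_maps R p e = {\<phi> \<in> carrier R \<rightarrow>\<^sub>E carrier R.
     (\<forall>s\<in>carrier R. \<forall>t\<in>carrier R. \<phi> (s \<oplus>\<^bsub>R\<^esub> t) = \<phi> s \<oplus>\<^bsub>R\<^esub> \<phi> t) \<and>
     (\<forall>r\<in>carrier R. \<forall>s\<in>carrier R. \<phi> (r [^]\<^bsub>R\<^esub> (p ^ e) \<otimes>\<^bsub>R\<^esub> s) = r \<otimes>\<^bsub>R\<^esub> \<phi> s)}"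

definition zero_map :: "('a, 'm) ring_scheme \<Rightarrow> 'a \<Rightarrow> 'a" where
  "zero_map R = (\<lambda>s\<in>carrier R. \<zero>\<^bsub>R\<^esub>)"

text \<open>
  An element of the direct sum is the family of its components. As a function between the
  underlying sets, \<open>\<phi> \<circ> F\<^sup>a\<^sub>*\<psi>\<close> is \<open>\<phi> \<circ> \<psi>\<close>.
\<close>

definition cartier_algebra :: "('a, 'm) ring_scheme \<Rightarrow> nat \<Rightarrow> (nat \<Rightarrow> 'a \<Rightarrow> 'a) ring" where
  "cartier_algebra R p =
    \<lparr>carrier = {\<Phi>. (\<forall>e. \<Phi> e \<in> cartier_maps R p e) \<and> finite {e. \<Phi> e \<noteq> zero_map R}},
     mult = (\<lambda>\<Phi> \<Psi> e. \<lambda>s\<in>carrier R. \<Oplus>\<^bsub>R\<^esub>a\<in>{..e}. \<Phi> a (\<Psi> (e - a) s)),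
     one = (\<lambda>e. if e = 0 then (\<lambda>s\<in>carrier R. s) else zero_map R),
     zero = (\<lambda>e. zero_map R),
     add = (\<lambda>\<Phi> \<Psi> e. \<lambda>s\<in>carrier R. \<Phi> e s \<oplus>\<^bsub>R\<^esub> \<Psi> e s)\<rparr>"

definition homog :: "('a, 'm) ring_scheme \<Rightarrow> nat \<Rightarrow> ('a \<Rightarrow> 'a) \<Rightarrow> nat \<Rightarrow> 'a \<Rightarrow> 'a" where
  "homog R e \<phi> = (\<lambda>i. if i = e then \<phi> else zero_map R)"

text \<open>The identification of \<open>R\<close> with \<open>Hom\<^sub>R(R, R)\<close>, the degree \<open>0\<close> part of the Cartier algebra.\<close>

definition scalar :: "('a, 'm) ring_scheme \<Rightarrow> 'a \<Rightarrow> nat \<Rightarrow> 'a \<Rightarrow> 'a" where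
  "scalar R r = homog R 0 (\<lambda>s\<in>carrier R. r \<otimes>\<^bsub>R\<^esub> s)"

text \<open>The homogeneous elements of degree \<open>e\<close> (and \<open>0\<close>) in a set of elements of the Cartier algebra.\<close>

definition degree_part ::
    "('a, 'm) ring_scheme \<Rightarrow> (nat \<Rightarrow> 'a \<Rightarrow> 'a) set \<Rightarrow> nat \<Rightarrow> (nat \<Rightarrow> 'a \<Rightarrow> 'a) set" where
  "degree_part R D e = {\<Phi> \<in> D. \<forall>i. i \<noteq> e \<longrightarrow> \<Phi> i = zero_map R}"

definition positive_part ::
    "('a, 'm) ring_scheme \<Rightarrow> (nat \<Rightarrow> 'a \<Rightarrow> 'a) set \<Rightarrow> (nat \<Rightarrow> 'a \<Rightarrow> 'a) set" where
  "positive_part R D = {\<Phi> \<in> D. \<Phi> 0 = zero_map R}"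

definition cartier_subalgebra ::
    "('a, 'm) ring_scheme \<Rightarrow> nat \<Rightarrow> (nat \<Rightarrow> 'a \<Rightarrow> 'a) set \<Rightarrow> bool" where
  "cartier_subalgebra R p D \<longleftrightarrow>
     subring D (cartier_algebra R p) \<and>
     (\<forall>\<Phi>\<in>D. \<forall>e. homog R e (\<Phi> e) \<in> D) \<and>
     degree_part R D 0 = scalar R ` carrier R \<and>
     (\<exists>e>0. degree_part R D e \<noteq> {\<zero>\<^bsub>cartier_algebra R p\<^esub>})"

text \<open>
  The right \<open>R\<close>-submodule generated by \<open>Y\<close>: the right action \<open>(\<phi> \<cdot> r)(s) = \<phi>(r s)\<close> is right
  multiplication by \<^term>\<open>scalar R r\<close> in the Cartier algebra.
\<close>

definition right_span ::
    "('a, 'm) ring_scheme \<Rightarrow> nat \<Rightarrow> (nat \<Rightarrow> 'a \<Rightarrow> 'a) set \<Rightarrow> (nat \<Rightarrow> 'a \<Rightarrow> 'a) set" where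
  "right_span R p Y =
    {(\<Oplus>\<^bsub>cartier_algebra R p\<^esub>\<Psi>\<in>F. \<Psi> \<otimes>\<^bsub>cartier_algebra R p\<^esub> scalar R (c \<Psi>)) |F c.
       finite F \<and> F \<subseteq> Y \<and> c \<in> F \<rightarrow> carrier R}"


section \<open>Complexity\<close>

text \<open>The index \<open>e\<close> is an integer \<open>\<ge> -1\<close>.\<close>

definition cartier_G ::
    "('a, 'm) ring_scheme \<Rightarrow> nat \<Rightarrow> (nat \<Rightarrow> 'a \<Rightarrow> 'a) set \<Rightarrow> int \<Rightarrow> (nat \<Rightarrow> 'a \<Rightarrow> 'a) set" where
  "cartier_G R p D e =
     (if e < 0 then degree_part R D 0
      else generate_ring (cartier_algebra R p) (\<Union>i\<le>nat e. degree_part R D i))"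

text \<open>The value is \<open>\<infinity>\<close> if there is no finite set of homogeneous generators.\<close>

definition cartier_k ::
    "('a, 'm) ring_scheme \<Rightarrow> nat \<Rightarrow> (nat \<Rightarrow> 'a \<Rightarrow> 'a) set \<Rightarrow> int \<Rightarrow> enat" where
  "cartier_k R p D e =
     Inf {enat (card X) |X. finite X \<and> X \<subseteq> (\<Union>i. degree_part R (cartier_G R p D e) i) \<and>
       generate_ring (cartier_algebra R p) (degree_part R D 0 \<union> X) = cartier_G R p D e}"

text \<open>
  The complexity is defined by the infimum only if all the \<open>k\<^sub>e\<close> are finite; it is set to \<open>\<infinity>\<close>
  otherwise, so an upper bound on the complexity also asserts this finiteness. In \<open>ereal\<close>
  the infimum of the empty set is \<open>\<infinity>\<close>.
\<close>

definition cartier_cx ::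
    "('a, 'm) ring_scheme \<Rightarrow> nat \<Rightarrow> (nat \<Rightarrow> 'a \<Rightarrow> 'a) set \<Rightarrow> ereal" where
  "cartier_cx R p D =
     (if \<forall>e\<ge>-1. cartier_k R p D e \<noteq> \<infinity>
      then Inf {ereal m |m. 0 < m \<and>
             (\<lambda>e::nat. real (the_enat (cartier_k R p D (int e)))
                       - real (the_enat (cartier_k R p D (int e - 1)))) \<in> O(\<lambda>e. m ^ e)}
      else \<infinity>)"


section \<open>Polynomial rings and gauges\<close>

type_synonym 'k mpol = "(nat \<Rightarrow>\<^sub>0 nat) \<Rightarrow>\<^sub>0 'k"

text \<open>
  The ring \<open>k[x\<^sub>1, \<dots>, x\<^sub>n]\<close>; the variables are indexed by \<open>0, \<dots>, n - 1\<close>, and a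
  monomial is its exponent vector.
\<close>

definition mpol_ring :: "nat \<Rightarrow> 'k::field mpol ring" where
  "mpol_ring n =
    \<lparr>carrier = {f. \<forall>\<alpha>\<in>Poly_Mapping.keys f. Poly_Mapping.keys \<alpha> \<subseteq> {..<n}},
     mult = (*), one = 1, zero = 0, add = (+)\<rparr>"

definition bounded_monoms :: "nat \<Rightarrow> nat \<Rightarrow> (nat \<Rightarrow>\<^sub>0 nat) set" where
  "bounded_monoms n d =
     {\<alpha>. Poly_Mapping.keys \<alpha> \<subseteq> {..<n} \<and> (\<forall>i<n. Poly_Mapping.lookup \<alpha> i \<le> d)}"

text \<open>The set \<^term>\<open>bounded_monoms n d\<close> is finite, so this is its \<open>k\<close>-linear span.\<close>

definition gauge_S :: "nat \<Rightarrow> nat \<Rightarrow> 'k::field mpol set" where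
  "gauge_S n d = {(\<Sum>\<alpha>\<in>bounded_monoms n d. Poly_Mapping.single \<alpha> (c \<alpha>)) |c. True}"

definition gauge_R :: "nat \<Rightarrow> 'k::field mpol set \<Rightarrow> int \<Rightarrow> 'k mpol set set" where
  "gauge_R n I d =
     (if d < 0 then {\<zero>\<^bsub>mpol_ring n Quot I\<^esub>}
      else (\<lambda>f. I +>\<^bsub>mpol_ring n\<^esub> f) ` gauge_S n (nat d))"

definition gauge :: "nat \<Rightarrow> 'k::field mpol set \<Rightarrow> 'k mpol set \<Rightarrow> ereal" where
  "gauge n I r =
     (if r = \<zero>\<^bsub>mpol_ring n Quot I\<^esub> then -\<infinity>
      else ereal (real_of_int (THE d. r \<in> gauge_R n I d - gauge_R n I (d - 1))))"

text \<open>
  The generators \<open>\<psi>\<^sub>i\<close> are given as a set of pairs \<open>(e\<^sub>i, \<psi>\<^sub>i)\<close>. In \<open>ereal\<close> one has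
  \<open>-\<infinity> / p\<^sup>e + K = -\<infinity>\<close>.
\<close>

definition gauge_bounded ::
    "nat \<Rightarrow> 'k::field mpol set \<Rightarrow> nat \<Rightarrow> (nat \<Rightarrow> 'k mpol set \<Rightarrow> 'k mpol set) set \<Rightarrow> bool" where
  "gauge_bounded n I p D \<longleftrightarrow>
     (\<exists>X (K::real).
        (\<forall>(e, \<Psi>)\<in>X. 1 \<le> e \<and> \<Psi> \<in> degree_part (mpol_ring n Quot I) D e) \<and>
        right_span (mpol_ring n Quot I) p (snd ` X) = positive_part (mpol_ring n Quot I) D \<and>
        (\<forall>(e, \<Psi>)\<in>X. \<forall>r\<in>carrier (mpol_ring n Quot I).
           gauge n I (\<Psi> e r) \<le> gauge n I r / ereal (real p ^ e) + ereal K))"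

end

theory Submission
  imports
    Defs
    "HOL-Computational_Algebra.Primes"
    "HOL-Algebra.QuotRing"
begin

text \<open>
  By gauge boundedness the generators of degree \<open>e\<close> lie in the space \<open>V\<^sub>e\<close> of all \<open>\<phi> \<in> D\<^sub>e\<close> that map
  \<open>R\<^bsub>p^e-1\<^esub>\<close> into \<open>R\<^sub>d\<close>, where \<open>d \<ge> K + 1\<close> does not depend on \<open>e\<close>. An element of \<open>V\<^sub>e\<close> is determined by
  its values on the \<open>p\<^bsup>en\<^esup>\<close> lines \<open>k x\<^sup>\<alpha>\<close> with exponents below \<open>p\<^sup>e\<close>, hence by at most
  \<open>(d + 1)\<^sup>n p\<^bsup>en\<^esup>\<close> elements of \<open>Hom\<^sub>k(F\<^sup>e\<^sub>*k, k)\<close>. Since \<open>k\<close> is \<open>F\<close>-finite, the latter is at most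
  one-dimensional for the right action of \<open>k\<close>, so \<open>V\<^sub>e\<close> is generated by \<open>(d + 1)\<^sup>n p\<^bsup>en\<^esup>\<close> elements as a
  right \<open>k\<close>-space; the left dimension would contribute a further factor \<open>[k : k\<^bsup>p^e\<^esup>]\<close>.
  Summing over degrees gives \<open>k\<^sub>e \<le> (d + 1)\<^sup>n e p\<^bsup>en\<^esup>\<close>, which is \<open>O(m\<^sup>e)\<close> for every \<open>m > p\<^sup>n\<close>, so no
  comparison of \<open>k\<^sub>e\<close> with \<open>k\<^bsub>e-1\<^esub>\<close> is needed.
\<close>

section \<open>Cartier algebras and complexity\<close>

lemma generate_ring_subsetI:
  assumes "A \<subseteq> generate_ring R B"
  shows "generate_ring R A \<subseteq> generate_ring R B"
proof
  fix x assume "x \<in> generate_ring R A"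
  then show "x \<in> generate_ring R B"
    by induction (use assms in \<open>auto intro: generate_ring.intros\<close>)
qed

context cring
begin

section \<open>Semilinear maps and the additive group of the Cartier algebra\<close>

lemma cartier_maps_closed: "\<phi> \<in> cartier_maps R p e \<Longrightarrow> s \<in> carrier R \<Longrightarrow> \<phi> s \<in> carrier R"
  unfolding cartier_maps_def by (auto simp: PiE_def)

lemma cartier_maps_ext: "\<phi> \<in> cartier_maps R p e \<Longrightarrow> \<phi> \<in> extensional (carrier R)"
  unfolding cartier_maps_def by (auto simp: PiE_def)

lemma cartier_maps_add:
  "\<phi> \<in> cartier_maps R p e \<Longrightarrow> s \<in> carrier R \<Longrightarrow> t \<in> carrier R \<Longrightarrow> \<phi> (s \<oplus> t) = \<phi> s \<oplus> \<phi> t"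
  unfolding cartier_maps_def by auto

lemma cartier_maps_semilinear:
  "\<phi> \<in> cartier_maps R p e \<Longrightarrow> r \<in> carrier R \<Longrightarrow> s \<in> carrier R \<Longrightarrow> \<phi> (r [^] (p ^ e) \<otimes> s) = r \<otimes> \<phi> s"
  unfolding cartier_maps_def by auto

lemma cartier_maps_zero:
  assumes "\<phi> \<in> cartier_maps R p e" shows "\<phi> \<zero> = \<zero>"
proof -
  have "\<phi> (\<zero> \<oplus> \<zero>) = \<phi> \<zero> \<oplus> \<phi> \<zero>"
    using cartier_maps_add[OF assms] by blast
  then show ?thesis
    using cartier_maps_closed[OF assms zero_closed]
    by (metis add.l_cancel_one' zero_closed l_zero)
qed

lemma zero_map_apply [simp]: "s \<in> carrier R \<Longrightarrow> zero_map R s = \<zero>"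
  by (simp add: zero_map_def)

lemma zero_map_in_cartier_maps: "zero_map R \<in> cartier_maps R p e"
  unfolding cartier_maps_def zero_map_def by auto

lemma cartier_maps_eqI:
  assumes "\<phi> \<in> cartier_maps R p e" "\<psi> \<in> cartier_maps R p e'" "\<And>s. s \<in> carrier R \<Longrightarrow> \<phi> s = \<psi> s"
  shows "\<phi> = \<psi>"
  using assms cartier_maps_ext by (meson extensionalityI)

lemma cartier_maps_plus:
  assumes "\<phi> \<in> cartier_maps R p e" "\<psi> \<in> cartier_maps R p e"
  shows "(\<lambda>s\<in>carrier R. \<phi> s \<oplus> \<psi> s) \<in> cartier_maps R p e"
  using cartier_maps_closed[OF assms(1)] cartier_maps_closed[OF assms(2)]
  by (auto simp: cartier_maps_def[of R p e] cartier_maps_add[OF assms(1)] cartier_maps_add[OF assms(2)]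
      cartier_maps_semilinear[OF assms(1)] cartier_maps_semilinear[OF assms(2)] r_distr add.m_ac)

lemma cartier_maps_uminus:
  assumes "\<phi> \<in> cartier_maps R p e"
  shows "(\<lambda>s\<in>carrier R. \<ominus> \<phi> s) \<in> cartier_maps R p e"
  using cartier_maps_closed[OF assms(1)]
  by (auto simp: cartier_maps_def[of R p e] cartier_maps_add[OF assms(1)]
      cartier_maps_semilinear[OF assms(1)] r_minus minus_add)

lemma cartier_algebra_carrierD:
  "\<Phi> \<in> carrier (cartier_algebra R p) \<Longrightarrow> \<Phi> e \<in> cartier_maps R p e"
  by (simp add: cartier_algebra_def)

lemma cartier_algebra_eqI:
  assumes "\<Phi> \<in> carrier (cartier_algebra R p)" "\<Psi> \<in> carrier (cartier_algebra R p)"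
    "\<And>e s. s \<in> carrier R \<Longrightarrow> \<Phi> e s = \<Psi> e s"
  shows "\<Phi> = \<Psi>"
  using assms cartier_maps_eqI cartier_algebra_carrierD by (metis ext)

lemma cartier_algebra_add_apply:
  "s \<in> carrier R \<Longrightarrow> (\<Phi> \<oplus>\<^bsub>cartier_algebra R p\<^esub> \<Psi>) e s = \<Phi> e s \<oplus> \<Psi> e s"
  by (simp add: cartier_algebra_def)

lemma cartier_algebra_zero: "\<zero>\<^bsub>cartier_algebra R p\<^esub> = (\<lambda>e. zero_map R)"
  by (simp add: cartier_algebra_def)

lemma cartier_algebra_add_closed:
  assumes "\<Phi> \<in> carrier (cartier_algebra R p)" "\<Psi> \<in> carrier (cartier_algebra R p)"
  shows "\<Phi> \<oplus>\<^bsub>cartier_algebra R p\<^esub> \<Psi> \<in> carrier (cartier_algebra R p)"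
proof -
  have "(\<lambda>s\<in>carrier R. \<Phi> e s \<oplus> \<Psi> e s) = zero_map R"
    if "\<Phi> e = zero_map R" "\<Psi> e = zero_map R" for e
    unfolding that by (auto simp: zero_map_def)
  then have "{e. (\<lambda>s\<in>carrier R. \<Phi> e s \<oplus> \<Psi> e s) \<noteq> zero_map R}
      \<subseteq> {e. \<Phi> e \<noteq> zero_map R} \<union> {e. \<Psi> e \<noteq> zero_map R}"
    by blast
  moreover have "finite \<dots>"
    using assms by (simp add: cartier_algebra_def)
  ultimately have "finite {e. (\<lambda>s\<in>carrier R. \<Phi> e s \<oplus> \<Psi> e s) \<noteq> zero_map R}"
    using finite_subset by blast
  then show ?thesis
    using assms by (simp add: cartier_algebra_def cartier_maps_plus)
qed

text \<open>Gives access to the finite sums in \<open>right_span\<close> and to cancellation with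
  the negatives of elements of a subring. The axioms hold componentwise on the carrier, and
  extensionality turns this into equality of families.\<close>

lemma abelian_group_cartier_algebra: "abelian_group (cartier_algebra R p)" (is "abelian_group ?C")
proof (rule abelian_groupI)
  have zero: "\<zero>\<^bsub>?C\<^esub> \<in> carrier ?C"
    by (simp add: cartier_algebra_def zero_map_in_cartier_maps)
  then show "\<zero>\<^bsub>?C\<^esub> \<in> carrier ?C" .
  fix \<Phi> assume \<Phi>: "\<Phi> \<in> carrier ?C"
  have c\<Phi>: "\<Phi> e s \<in> carrier R" if "s \<in> carrier R" for e s
    using cartier_algebra_carrierD[OF \<Phi>] cartier_maps_closed that by blast
  show "\<zero>\<^bsub>?C\<^esub> \<oplus>\<^bsub>?C\<^esub> \<Phi> = \<Phi>"
    by (rule cartier_algebra_eqI[OF cartier_algebra_add_closed[OF zero \<Phi>] \<Phi>])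
      (simp add: cartier_algebra_add_apply cartier_algebra_zero c\<Phi>)
  define \<Psi> where "\<Psi> = (\<lambda>e. \<lambda>s\<in>carrier R. \<ominus> \<Phi> e s)"
  have "\<Psi> e = zero_map R" if "\<Phi> e = zero_map R" for e
    unfolding \<Psi>_def that by (auto simp: zero_map_def)
  then have "{e. \<Psi> e \<noteq> zero_map R} \<subseteq> {e. \<Phi> e \<noteq> zero_map R}"
    by blast
  then have "finite {e. \<Psi> e \<noteq> zero_map R}"
    using \<Phi> finite_subset by (auto simp: cartier_algebra_def)
  then have \<Psi>: "\<Psi> \<in> carrier ?C"
    using \<Phi> by (simp add: cartier_algebra_def \<Psi>_def cartier_maps_uminus)
  have "\<Psi> \<oplus>\<^bsub>?C\<^esub> \<Phi> = \<zero>\<^bsub>?C\<^esub>"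
    by (rule cartier_algebra_eqI[OF cartier_algebra_add_closed[OF \<Psi> \<Phi>] zero])
      (simp add: cartier_algebra_add_apply cartier_algebra_zero c\<Phi> \<Psi>_def l_neg)
  then show "\<exists>\<Psi>\<in>carrier ?C. \<Psi> \<oplus>\<^bsub>?C\<^esub> \<Phi> = \<zero>\<^bsub>?C\<^esub>"
    using \<Psi> by blast
  fix \<Psi> assume \<Psi>: "\<Psi> \<in> carrier ?C"
  have c\<Psi>: "\<Psi> e s \<in> carrier R" if "s \<in> carrier R" for e s
    using cartier_algebra_carrierD[OF \<Psi>] cartier_maps_closed that by blast
  show "\<Phi> \<oplus>\<^bsub>?C\<^esub> \<Psi> \<in> carrier ?C"
    by (rule cartier_algebra_add_closed[OF \<Phi> \<Psi>])
  show "\<Phi> \<oplus>\<^bsub>?C\<^esub> \<Psi> = \<Psi> \<oplus>\<^bsub>?C\<^esub> \<Phi>"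
    by (rule cartier_algebra_eqI[OF cartier_algebra_add_closed[OF \<Phi> \<Psi>] cartier_algebra_add_closed[OF \<Psi> \<Phi>]])
      (simp add: cartier_algebra_add_apply c\<Phi> c\<Psi> a_comm)
  fix \<Omega> assume \<Omega>: "\<Omega> \<in> carrier ?C"
  have c\<Omega>: "\<Omega> e s \<in> carrier R" if "s \<in> carrier R" for e s
    using cartier_algebra_carrierD[OF \<Omega>] cartier_maps_closed that by blast
  show "\<Phi> \<oplus>\<^bsub>?C\<^esub> \<Psi> \<oplus>\<^bsub>?C\<^esub> \<Omega> = \<Phi> \<oplus>\<^bsub>?C\<^esub> (\<Psi> \<oplus>\<^bsub>?C\<^esub> \<Omega>)"
    by (rule cartier_algebra_eqI[OF cartier_algebra_add_closed[OF cartier_algebra_add_closed[OF \<Phi> \<Psi>] \<Omega>]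
          cartier_algebra_add_closed[OF \<Phi> cartier_algebra_add_closed[OF \<Psi> \<Omega>]]])
      (simp add: cartier_algebra_add_apply c\<Phi> c\<Psi> c\<Omega> a_assoc)
qed

section \<open>Right multiplication by scalars and the graded pieces\<close>

text \<open>In the convolution only the summand \<open>a = e\<close> meets the degree 0 component of
  the scalar. Every other summand is a component of \<Phi> applied to 0, hence 0.\<close>

lemma cartier_algebra_mult_scalar:
  assumes \<Phi>: "\<Phi> \<in> carrier (cartier_algebra R p)" and r: "r \<in> carrier R" and s: "s \<in> carrier R"
  shows "(\<Phi> \<otimes>\<^bsub>cartier_algebra R p\<^esub> scalar R r) e s = \<Phi> e (r \<otimes> s)"
proof -
  have z: "\<Phi> a \<zero> = \<zero>" for a
    using cartier_maps_zero[OF cartier_algebra_carrierD[OF \<Phi>]] .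
  have "(\<Phi> \<otimes>\<^bsub>cartier_algebra R p\<^esub> scalar R r) e s = (\<Oplus>a\<in>{..e}. \<Phi> a (scalar R r (e - a) s))"
    using s by (simp add: cartier_algebra_def)
  also have "\<dots> = (\<Oplus>a\<in>{..e}. if e = a then \<Phi> a (r \<otimes> s) else \<zero>)"
    using r s cartier_maps_closed[OF cartier_algebra_carrierD[OF \<Phi>]]
    by (intro add.finprod_cong') (auto simp: scalar_def homog_def z)
  also have "\<dots> = \<Phi> e (r \<otimes> s)"
    using r s cartier_maps_closed[OF cartier_algebra_carrierD[OF \<Phi>]]
    by (intro add.finprod_singleton) auto
  finally show ?thesis .
qed

lemma cartier_subalgebra_props:
  assumes "cartier_subalgebra R p D"
  shows "D \<subseteq> carrier (cartier_algebra R p)"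
    and "\<one>\<^bsub>cartier_algebra R p\<^esub> \<in> D"
    and "\<And>\<Phi>. \<Phi> \<in> D \<Longrightarrow> \<ominus>\<^bsub>cartier_algebra R p\<^esub> \<Phi> \<in> D"
    and "\<And>\<Phi> \<Psi>. \<Phi> \<in> D \<Longrightarrow> \<Psi> \<in> D \<Longrightarrow> \<Phi> \<oplus>\<^bsub>cartier_algebra R p\<^esub> \<Psi> \<in> D"
    and "\<And>\<Phi> \<Psi>. \<Phi> \<in> D \<Longrightarrow> \<Psi> \<in> D \<Longrightarrow> \<Phi> \<otimes>\<^bsub>cartier_algebra R p\<^esub> \<Psi> \<in> D"
    and "degree_part R D 0 = scalar R ` carrier R"
    and "\<And>r. r \<in> carrier R \<Longrightarrow> scalar R r \<in> D"
proof -
  have *: "subring D (cartier_algebra R p)" "degree_part R D 0 = scalar R ` carrier R"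
    using assms by (auto simp: cartier_subalgebra_def)
  show "D \<subseteq> carrier (cartier_algebra R p)" "\<one>\<^bsub>cartier_algebra R p\<^esub> \<in> D"
    "\<And>\<Phi>. \<Phi> \<in> D \<Longrightarrow> \<ominus>\<^bsub>cartier_algebra R p\<^esub> \<Phi> \<in> D"
    "\<And>\<Phi> \<Psi>. \<Phi> \<in> D \<Longrightarrow> \<Psi> \<in> D \<Longrightarrow> \<Phi> \<oplus>\<^bsub>cartier_algebra R p\<^esub> \<Psi> \<in> D"
    "\<And>\<Phi> \<Psi>. \<Phi> \<in> D \<Longrightarrow> \<Psi> \<in> D \<Longrightarrow> \<Phi> \<otimes>\<^bsub>cartier_algebra R p\<^esub> \<Psi> \<in> D"
    using subringE[OF *(1)] by auto
  show "degree_part R D 0 = scalar R ` carrier R" by (fact *(2))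
  then show "\<And>r. r \<in> carrier R \<Longrightarrow> scalar R r \<in> D"
    by (auto simp: degree_part_def)
qed

lemma degree_part_mult_scalar:
  assumes "cartier_subalgebra R p D" "\<Phi> \<in> degree_part R D e" "r \<in> carrier R"
  shows "\<Phi> \<otimes>\<^bsub>cartier_algebra R p\<^esub> scalar R r \<in> degree_part R D e"
proof -
  note D = cartier_subalgebra_props[OF assms(1)]
  have \<Phi>: "\<Phi> \<in> D" "\<And>i. i \<noteq> e \<Longrightarrow> \<Phi> i = zero_map R"
    using assms(2) by (auto simp: degree_part_def)
  have m: "\<Phi> \<otimes>\<^bsub>cartier_algebra R p\<^esub> scalar R r \<in> D"
    using D(5,7) \<Phi>(1) assms(3) by blast
  have "(\<Phi> \<otimes>\<^bsub>cartier_algebra R p\<^esub> scalar R r) i = zero_map R" if "i \<noteq> e" for i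
    using m D(1) cartier_algebra_carrierD \<Phi> that assms(3)
    by (intro cartier_maps_eqI[OF _ zero_map_in_cartier_maps])
      (auto simp: cartier_algebra_mult_scalar subset_eq)
  then show ?thesis
    using m by (simp add: degree_part_def)
qed

lemma degree_part_add:
  assumes "cartier_subalgebra R p D" "\<Phi> \<in> degree_part R D e" "\<Psi> \<in> degree_part R D e"
  shows "\<Phi> \<oplus>\<^bsub>cartier_algebra R p\<^esub> \<Psi> \<in> degree_part R D e"
proof -
  note D = cartier_subalgebra_props[OF assms(1)]
  have m: "\<Phi> \<oplus>\<^bsub>cartier_algebra R p\<^esub> \<Psi> \<in> D"
    using D(4) assms by (auto simp: degree_part_def)
  have "(\<Phi> \<oplus>\<^bsub>cartier_algebra R p\<^esub> \<Psi>) i = zero_map R" if "i \<noteq> e" for i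
    using m D(1) cartier_algebra_carrierD that assms
    by (intro cartier_maps_eqI[OF _ zero_map_in_cartier_maps])
      (auto simp: cartier_algebra_add_apply degree_part_def subset_eq)
  then show ?thesis
    using m by (simp add: degree_part_def)
qed

lemma degree_part_uminus:
  assumes "cartier_subalgebra R p D" "\<Phi> \<in> degree_part R D e"
  shows "\<ominus>\<^bsub>cartier_algebra R p\<^esub> \<Phi> \<in> degree_part R D e"
proof -
  note D = cartier_subalgebra_props[OF assms(1)]
  interpret C: abelian_group "cartier_algebra R p" by (rule abelian_group_cartier_algebra)
  let ?\<Psi> = "\<ominus>\<^bsub>cartier_algebra R p\<^esub> \<Phi>"
  have \<Phi>: "\<Phi> \<in> D" "\<And>i. i \<noteq> e \<Longrightarrow> \<Phi> i = zero_map R"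
    using assms(2) by (auto simp: degree_part_def)
  have m: "?\<Psi> \<in> D" using D(3) \<Phi> by blast
  have "?\<Psi> i = zero_map R" if "i \<noteq> e" for i
  proof (rule cartier_maps_eqI[OF _ zero_map_in_cartier_maps])
    show \<Psi>: "?\<Psi> i \<in> cartier_maps R p i"
      using m D(1) cartier_algebra_carrierD by blast
    fix s assume s: "s \<in> carrier R"
    \<comment> \<open>The negative is given only abstractly, so its components are read off from the
      sum with \<Phi> being 0.\<close>
    have "(\<Phi> \<oplus>\<^bsub>cartier_algebra R p\<^esub> ?\<Psi>) i s = \<zero>"
      using C.r_neg \<Phi>(1) D(1) s by (auto simp: cartier_algebra_zero)
    then show "?\<Psi> i s = zero_map R s"
      using s that \<Phi>(2) cartier_maps_closed[OF \<Psi>]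
      by (simp add: cartier_algebra_add_apply)
  qed
  then show ?thesis
    using m by (simp add: degree_part_def)
qed

text \<open>Degree 0 consists of scalars, so a product of two such elements is a right multiple by a
  scalar and stays in degree 0.\<close>

lemma generate_ring_degree_0:
  assumes "cartier_subalgebra R p D"
  shows "generate_ring (cartier_algebra R p) (degree_part R D 0) = degree_part R D 0"
proof
  note D = cartier_subalgebra_props[OF assms(1)]
  show "generate_ring (cartier_algebra R p) (degree_part R D 0) \<subseteq> degree_part R D 0"
  proof
    fix \<Phi> assume "\<Phi> \<in> generate_ring (cartier_algebra R p) (degree_part R D 0)"
    then show "\<Phi> \<in> degree_part R D 0"
    proof induction
      case one
      show ?case
        using D(2) by (auto simp: degree_part_def) (simp add: cartier_algebra_def)
    next
      case (eng_mult \<Phi> \<Psi>)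
      then show ?case
        using degree_part_mult_scalar[OF assms, of \<Phi> 0] unfolding D(6) by blast
    qed (auto intro: degree_part_uminus[OF assms] degree_part_add[OF assms])
  qed
qed (auto intro: generate_ring.incl)

text \<open>The degree \<open>e\<close> component of a right combination only involves the generators of degree \<open>e\<close>.\<close>

lemma degree_part_subset_of_right_span:
  assumes D: "cartier_subalgebra R p D"
    and X: "\<And>i \<Psi>. (i, \<Psi>) \<in> X \<Longrightarrow> \<Psi> \<in> degree_part R D i"
    and span: "right_span R p (snd ` X) = positive_part R D"
    and e: "e > 0"
    and H: "\<zero>\<^bsub>cartier_algebra R p\<^esub> \<in> H"
      "\<And>\<Phi> \<Psi>. \<Phi> \<in> H \<Longrightarrow> \<Psi> \<in> H \<Longrightarrow> \<Phi> \<oplus>\<^bsub>cartier_algebra R p\<^esub> \<Psi> \<in> H"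
      "\<And>\<Psi> r. (e, \<Psi>) \<in> X \<Longrightarrow> r \<in> carrier R \<Longrightarrow> \<Psi> \<otimes>\<^bsub>cartier_algebra R p\<^esub> scalar R r \<in> H"
  shows "degree_part R D e \<subseteq> H"
proof
  let ?C = "cartier_algebra R p"
  interpret C: abelian_group ?C by (rule abelian_group_cartier_algebra)
  note DD = cartier_subalgebra_props[OF D]
  fix \<Phi> assume \<Phi>: "\<Phi> \<in> degree_part R D e"
  have homog_self: "homog R i (\<Psi> i) = \<Psi>" if "\<Psi> \<in> degree_part R D i" for i \<Psi>
    using that by (auto simp: homog_def degree_part_def fun_eq_iff)
  have homog_carrier: "homog R e (\<Psi> e) \<in> carrier ?C" if "\<Psi> \<in> carrier ?C" for \<Psi>
    using that by (auto simp: homog_def cartier_algebra_def zero_map_in_cartier_maps)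
  \<comment> \<open>Projection to degree \<open>e\<close> is additive, so it can be pushed through
    the finite right combination below.\<close>
  have homog_add: "homog R e ((\<Psi> \<oplus>\<^bsub>?C\<^esub> \<Omega>) e) = homog R e (\<Psi> e) \<oplus>\<^bsub>?C\<^esub> homog R e (\<Omega> e)"
    if "\<Psi> \<in> carrier ?C" "\<Omega> \<in> carrier ?C" for \<Psi> \<Omega>
    using that by (intro cartier_algebra_eqI[where p = p] homog_carrier C.a_closed)
      (auto simp: homog_def cartier_algebra_add_apply)
  have "\<Phi> \<in> positive_part R D"
    using \<Phi> e by (auto simp: positive_part_def degree_part_def)
  then obtain F c where F: "finite F" "F \<subseteq> snd ` X" "c \<in> F \<rightarrow> carrier R"
    and \<Phi>F: "\<Phi> = (\<Oplus>\<^bsub>?C\<^esub>\<Psi>\<in>F. \<Psi> \<otimes>\<^bsub>?C\<^esub> scalar R (c \<Psi>))"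
    unfolding span[symmetric] right_span_def by auto
  have summand: "\<Psi> \<otimes>\<^bsub>?C\<^esub> scalar R (c \<Psi>) \<in> carrier ?C \<and> homog R e ((\<Psi> \<otimes>\<^bsub>?C\<^esub> scalar R (c \<Psi>)) e) \<in> H"
    if \<Psi>F: "\<Psi> \<in> F" for \<Psi>
  proof -
    obtain i where i: "(i, \<Psi>) \<in> X" using F \<Psi>F by auto
    have c: "c \<Psi> \<in> carrier R" using F \<Psi>F by auto
    have d: "\<Psi> \<otimes>\<^bsub>?C\<^esub> scalar R (c \<Psi>) \<in> degree_part R D i"
      by (rule degree_part_mult_scalar[OF D X[OF i] c])
    then have "\<Psi> \<otimes>\<^bsub>?C\<^esub> scalar R (c \<Psi>) \<in> carrier ?C"
      using DD(1) by (auto simp: degree_part_def)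
    moreover have "homog R e ((\<Psi> \<otimes>\<^bsub>?C\<^esub> scalar R (c \<Psi>)) e) \<in> H"
    proof (cases "i = e")
      case True
      then show ?thesis using H(3) i c homog_self[OF d] by auto
    next
      case False
      then have "homog R e ((\<Psi> \<otimes>\<^bsub>?C\<^esub> scalar R (c \<Psi>)) e) = \<zero>\<^bsub>?C\<^esub>"
        using d by (auto simp: homog_def degree_part_def cartier_algebra_zero fun_eq_iff)
      then show ?thesis using H(1) by simp
    qed
    ultimately show ?thesis by blast
  qed
  have "homog R e ((\<Oplus>\<^bsub>?C\<^esub>\<Psi>\<in>F. \<Psi> \<otimes>\<^bsub>?C\<^esub> scalar R (c \<Psi>)) e) \<in> H"
    using F(1) summand
  proof (induction F)
    case empty
    have "homog R e (\<zero>\<^bsub>?C\<^esub> e) = \<zero>\<^bsub>?C\<^esub>"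
      by (auto simp: homog_def cartier_algebra_zero)
    then show ?case using H(1) by simp
  next
    case (insert \<Psi> F)
    have "(\<Oplus>\<^bsub>?C\<^esub>\<Psi>\<in>F. \<Psi> \<otimes>\<^bsub>?C\<^esub> scalar R (c \<Psi>)) \<in> carrier ?C"
      using insert by (intro C.finsum_closed) auto
    moreover have "(\<Oplus>\<^bsub>?C\<^esub>\<Psi>\<in>insert \<Psi> F. \<Psi> \<otimes>\<^bsub>?C\<^esub> scalar R (c \<Psi>)) =
      \<Psi> \<otimes>\<^bsub>?C\<^esub> scalar R (c \<Psi>) \<oplus>\<^bsub>?C\<^esub> (\<Oplus>\<^bsub>?C\<^esub>\<Psi>\<in>F. \<Psi> \<otimes>\<^bsub>?C\<^esub> scalar R (c \<Psi>))"
      using insert by (intro C.finsum_insert) auto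
    ultimately show ?case
      using insert H(2) by (auto simp: homog_add)
  qed
  then show "\<Phi> \<in> H"
    using homog_self[OF \<Phi>] \<Phi>F by metis
qed

section \<open>Numbers of generators and their growth\<close>

lemma cartier_k_minus_one:
  assumes "cartier_subalgebra R p D"
  shows "cartier_k R p D (- 1) = 0"
proof -
  have "cartier_k R p D (- 1) \<le> enat (card {})"
    unfolding cartier_k_def
    by (intro Inf_lower CollectI exI[of _ "{}"]) (auto simp: cartier_G_def generate_ring_degree_0[OF assms])
  then show ?thesis by (simp flip: zero_enat_def)
qed

text \<open>Degree 0 belongs to the base ring and costs nothing, so the union of the chosen sets in
  degrees 1 to \<open>e\<close> generates \<open>G_e\<close>. Overlaps between these sets can only
  lower the count.\<close>

lemma cartier_k_le:
  assumes D: "cartier_subalgebra R p D"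
    and Y: "\<And>i. i \<in> {1..e} \<Longrightarrow> finite (Y i)" "\<And>i. i \<in> {1..e} \<Longrightarrow> Y i \<subseteq> degree_part R D i"
      "\<And>i. i \<in> {1..e} \<Longrightarrow>
        degree_part R D i \<subseteq> generate_ring (cartier_algebra R p) (degree_part R D 0 \<union> Y i)"
  shows "cartier_k R p D (int e) \<le> enat (\<Sum>i=1..e. card (Y i))"
proof -
  let ?C = "cartier_algebra R p"
  define X where "X = (\<Union>i\<in>{1..e}. Y i)"
  have G: "cartier_G R p D (int e) = generate_ring ?C (\<Union>i\<le>e. degree_part R D i)"
    by (simp add: cartier_G_def)
  have sub: "degree_part R D 0 \<union> X \<subseteq> (\<Union>i\<le>e. degree_part R D i)"
    using Y(2) by (fastforce simp: X_def)
  have "degree_part R D i \<subseteq> generate_ring ?C (degree_part R D 0 \<union> X)" if "i \<le> e" for i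
  proof (cases "i = 0")
    case True
    then show ?thesis by (auto intro: generate_ring.incl)
  next
    case False
    then have i: "i \<in> {1..e}" using that by auto
    have "generate_ring ?C (degree_part R D 0 \<union> Y i) \<subseteq> generate_ring ?C (degree_part R D 0 \<union> X)"
      using i by (intro generate_ring_subsetI) (auto simp: X_def intro: generate_ring.incl)
    then show ?thesis using Y(3)[OF i] by blast
  qed
  then have "cartier_G R p D (int e) \<subseteq> generate_ring ?C (degree_part R D 0 \<union> X)"
    unfolding G by (intro generate_ring_subsetI) blast
  moreover have "generate_ring ?C (degree_part R D 0 \<union> X) \<subseteq> cartier_G R p D (int e)"
    unfolding G using sub by (intro generate_ring_subsetI) (auto intro: generate_ring.incl)
  ultimately have gen: "generate_ring ?C (degree_part R D 0 \<union> X) = cartier_G R p D (int e)"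
    by blast
  have "X \<subseteq> (\<Union>i. degree_part R (cartier_G R p D (int e)) i)"
  proof
    fix \<Phi> assume "\<Phi> \<in> X"
    then obtain i where i: "i \<in> {1..e}" "\<Phi> \<in> degree_part R D i" using Y(2) unfolding X_def by blast
    then have "\<Phi> \<in> cartier_G R p D (int e)"
      unfolding G by (intro generate_ring.incl) auto
    then show "\<Phi> \<in> (\<Union>i. degree_part R (cartier_G R p D (int e)) i)"
      using i by (auto simp: degree_part_def)
  qed
  moreover have "finite X" using Y(1) by (auto simp: X_def)
  ultimately have "cartier_k R p D (int e) \<le> enat (card X)"
    unfolding cartier_k_def using gen by (intro Inf_lower) blast
  moreover have "card X \<le> (\<Sum>i=1..e. card (Y i))"
    unfolding X_def by (rule card_UN_le) simp
  ultimately show ?thesis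
    by (meson enat_ord_simps(1) order_trans)
qed

end

text \<open>A larger exponential base absorbs the linear factor, because \<open>e (M / m)^e\<close>
  tends to 0 and is therefore bounded.\<close>

lemma times_power_bigo:
  fixes M m :: real
  assumes "0 \<le> M" "M < m" and "\<And>e. \<bar>f e\<bar> \<le> c * (real e * M ^ e)"
  shows "f \<in> O(\<lambda>e. m ^ e)"
proof -
  have "(\<lambda>e. real e * (M / m) ^ e) \<longlonglongrightarrow> 0" (is "?X \<longlonglongrightarrow> 0")
    using assms by (intro powser_times_n_limit_0) auto
  then have "Bseq ?X" by (intro convergent_imp_Bseq convergentI)
  then obtain B where B: "B > 0" "\<forall>e. norm (?X e) \<le> B" by (rule BseqE)
  have "norm (f e) \<le> (\<bar>c\<bar> * B) * norm (m ^ e)" for e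
  proof -
    have m: "m ^ e > 0" using assms by simp
    have "real e * M ^ e = real e * (M / m) ^ e * m ^ e"
      using assms by (simp add: power_divide)
    also have "\<dots> \<le> B * m ^ e"
      using B(2)[rule_format, of e] m by (intro mult_right_mono) auto
    finally have *: "real e * M ^ e \<le> B * m ^ e" .
    have "\<bar>f e\<bar> \<le> \<bar>c\<bar> * (real e * M ^ e)"
      using assms(1) by (intro order_trans[OF assms(3)] mult_right_mono) auto
    also have "\<dots> \<le> \<bar>c\<bar> * (B * m ^ e)"
      using * by (intro mult_left_mono) auto
    finally show ?thesis using m by (simp add: mult.assoc)
  qed
  then show ?thesis by (intro bigoI always_eventually) blast
qed

text \<open>The factor \<open>e\<close> in the bound is absorbed by every growth rate
  \<open>m > M\<close>; letting \<open>m\<close> decrease to \<open>M\<close> gives the bound on the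
  infimum.\<close>

lemma cartier_cx_le:
  assumes k0: "cartier_k R p D (- 1) = 0"
    and k: "\<And>e::nat. cartier_k R p D (int e) \<le> enat (N * e * M ^ e)" and M: "M > 0"
  shows "cartier_cx R p D \<le> ereal (real M)"
proof -
  have fin: "cartier_k R p D e \<noteq> \<infinity>" if "e \<ge> - 1" for e
  proof (cases "e = - 1")
    case False
    then have "int (nat e) = e" using that by simp
    then show ?thesis using k[of "nat e"] by (metis enat_ord_simps(5) infinity_ne_i0 enat.distinct(2))
  qed (simp add: k0)
  define a where "a e = real (the_enat (cartier_k R p D e))" for e
  have a: "0 \<le> a (int e)" "a (int e) \<le> real N * (real e * real M ^ e)" for e
  proof -
    obtain j where j: "cartier_k R p D (int e) = enat j" using fin[of "int e"] by auto
    then have "j \<le> N * e * M ^ e" using k[of e] by simp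
    then have "real j \<le> real (N * e * M ^ e)" by (simp only: of_nat_le_iff)
    then show "0 \<le> a (int e)" "a (int e) \<le> real N * (real e * real M ^ e)"
      by (simp_all add: a_def j mult.assoc)
  qed
  \<comment> \<open>Both terms lie between 0 and the bound for \<open>e\<close>, hence so does the
    absolute difference. At \<open>e = 0\<close> both terms are 0.\<close>
  have diff: "\<bar>a (int e) - a (int e - 1)\<bar> \<le> real N * (real e * real M ^ e)" for e
  proof (cases e)
    case 0
    then show ?thesis using a[of 0] k0 by (simp add: a_def zero_enat_def)
  next
    case (Suc e')
    have "real e' * real M ^ e' \<le> real e * real M ^ e"
      using M Suc by (intro mult_mono power_increasing) auto
    then have "real N * (real e' * real M ^ e') \<le> real N * (real e * real M ^ e)"
      by (rule mult_left_mono) simp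
    then have "a (int e') \<le> real N * (real e * real M ^ e)"
      using a(2)[of e'] by linarith
    then show ?thesis
      using a[of e] a(1)[of e'] Suc by (simp add: abs_le_iff)
  qed
  have "cartier_cx R p D \<le> ereal m" if "real M < m" for m
  proof -
    have "(\<lambda>e::nat. a (int e) - a (int e - 1)) \<in> O(\<lambda>e. m ^ e)"
      using that diff by (intro times_power_bigo[of "real M"]) auto
    then show ?thesis
      using fin that unfolding cartier_cx_def a_def by (auto intro!: Inf_lower)
  qed
  then show ?thesis
    by - (rule ereal_le_epsilon2, simp)
qed

section \<open>Functionals on the Frobenius pushforward of a field\<close>

lemma freshman_power:
  fixes a b :: "'k::field"
  assumes "CHAR('k) = p" "p > 0"
  shows "(a + b) ^ p ^ e = a ^ p ^ e + b ^ p ^ e" and "sum f A ^ p ^ e = (\<Sum>i\<in>A. f i ^ p ^ e :: 'k)"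
proof -
  have "prime CHAR('k)" using assms prime_CHAR_semidom by blast
  then show "(a + b) ^ p ^ e = a ^ p ^ e + b ^ p ^ e" "sum f A ^ p ^ e = (\<Sum>i\<in>A. f i ^ p ^ e)"
    using freshmans_dream'[of "p ^ e" e a b] freshmans_dream_sum'[of "p ^ e" e f A] assms(1) by auto
qed

text \<open>\<open>F\<^sup>e\<^sub>*k\<close> as a vector space over \<open>k\<close>.\<close>

lemma vector_space_frobenius:
  assumes "CHAR('k::field) = p" "p > 0"
  shows "vector_space (\<lambda>c x. c ^ p ^ e * (x :: 'k))"
  by unfold_locales (auto simp: freshman_power[OF assms] algebra_simps power_mult_distrib)

text \<open>Induction along Frobenius: if \<open>B\<close> spans the \<open>e\<close>-th pushforward
  and \<open>B1\<close> the first, the products \<open>b1 ^ p ^ e * b\<close> span the next one.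
  Each coefficient is expanded over \<open>B1\<close>, and \<open>p ^ e\<close>-th powers are
  additive.\<close>

lemma finite_span_frobenius:
  assumes "CHAR('k::field) = p" "p > 0" and F: "F_finite_field TYPE('k)"
  shows "\<exists>B. finite B \<and> module.span (\<lambda>c x. c ^ p ^ e * (x :: 'k)) B = UNIV"
proof (induction e)
  case 0
  interpret vector_space "\<lambda>c x. c ^ p ^ 0 * (x :: 'k)"
    by (rule vector_space_frobenius[OF assms(1,2)])
  have "x \<in> span {1}" for x
    using span_scale[OF span_base[of 1 "{1}"], of x] by simp
  then show ?case by (intro exI[of _ "{1}"]) auto
next
  case (Suc e)
  then obtain B where B: "finite B" "module.span (\<lambda>c x. c ^ p ^ e * (x :: 'k)) B = UNIV" by blast
  obtain B1 :: "'k set" where B1: "finite B1" "\<And>x. \<exists>c. x = (\<Sum>b\<in>B1. c b ^ p * b)"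
    using F unfolding F_finite_field_def assms(1) by blast
  interpret V: vector_space "\<lambda>c x. c ^ p ^ e * (x :: 'k)"
    by (rule vector_space_frobenius[OF assms(1,2)])
  interpret W: vector_space "\<lambda>c x. c ^ p ^ Suc e * (x :: 'k)"
    by (rule vector_space_frobenius[OF assms(1,2)])
  define B' where "B' = (\<lambda>(b, b1). b1 ^ p ^ e * b) ` (B \<times> B1)"
  have "x \<in> W.span B'" for x
  proof -
    have "x \<in> V.span B" using B by simp
    then show ?thesis
    proof (induction rule: V.span_induct_alt)
      case base
      then show ?case by (rule W.span_zero)
    next
      case (step c b y)
      obtain d where d: "c = (\<Sum>b\<in>B1. d b ^ p * b)" using B1 by blast
      have "c ^ p ^ e * b = (\<Sum>b1\<in>B1. d b1 ^ p ^ Suc e * (b1 ^ p ^ e * b))"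
        unfolding d freshman_power[OF assms(1,2)]
        by (simp add: sum_distrib_right power_mult_distrib mult.assoc flip: power_mult)
      also have "\<dots> \<in> W.span B'"
        using step by (intro W.span_sum W.span_scale W.span_base) (auto simp: B'_def)
      finally show ?case using step W.span_add by blast
    qed
  qed
  then show ?case
    using B(1) B1(1) by (intro exI[of _ B']) (auto simp: B'_def)
qed

text \<open>For \<open>q = p^e\<close> this is \<open>Hom\<^sub>k(F\<^sup>e\<^sub>*k, k)\<close>.\<close>

definition root_linear :: "nat \<Rightarrow> ('k::field \<Rightarrow> 'k) set" where
  "root_linear q = {f. (\<forall>x y. f (x + y) = f x + f y) \<and> (\<forall>c x. f (c ^ q * x) = c * f x)}"

lemma root_linear_minus:
  assumes "f \<in> root_linear q" shows "f (- x) = - f x"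
proof -
  have add: "f (x + y) = f x + f y" for x y
    using assms by (auto simp: root_linear_def)
  have "f 0 + f 0 = f 0" using add[of 0 0] by simp
  then have "f 0 = 0" by (metis add_cancel_right_right)
  then have "f x + f (- x) = 0" using add[of x "- x"] by simp
  then show ?thesis by (simp add: add_eq_0_iff)
qed

text \<open>As a right \<open>k\<close>-space, \<open>Hom\<^sub>k(F\<^sup>e\<^sub>*k, k)\<close> has dimension at most \<open>1\<close>. With a basis \<open>B\<close> of
  \<open>F\<^sup>e\<^sub>*k\<close> over \<open>k\<close>, the map sending \<open>c\<close> to the functional \<open>x \<mapsto> f (c x)\<close>, read off on \<open>B\<close> and
  reassembled into an element of \<open>F\<^sup>e\<^sub>*k\<close>, is an injective endomorphism of \<open>F\<^sup>e\<^sub>*k\<close>.\<close>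

lemma root_linear_twist:
  fixes f g :: "'k::field \<Rightarrow> 'k"
  assumes k: "CHAR('k) = p" "p > 0" "F_finite_field TYPE('k)"
    and f: "f \<in> root_linear (p ^ e)" and g: "g \<in> root_linear (p ^ e)" and nz: "f x0 \<noteq> 0"
  shows "\<exists>c. \<forall>x. g x = f (c * x)"
proof -
  let ?s = "\<lambda>c x. c ^ p ^ e * (x :: 'k)"
  interpret vector_space ?s
    by (rule vector_space_frobenius[OF k(1,2)])
  obtain S where S: "finite S" "span S = UNIV"
    using finite_span_frobenius[OF k] by blast
  obtain B where B: "independent B" "UNIV \<subseteq> span B"
    using maximal_independent_subset[of UNIV] by metis
  have fB: "finite B"
    using independent_span_bound[OF S(1) B(1)] S(2) by auto
  interpret finite_dimensional_vector_space ?s B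
    using B fB by unfold_locales auto
  have f1: "f (x + y) = f x + f y" "f (c ^ p ^ e * x) = c * f x" for x y c
    using f by (auto simp: root_linear_def)
  have g1: "g (x + y) = g x + g y" "g (c ^ p ^ e * x) = c * g x" for x y c
    using g by (auto simp: root_linear_def)
  have pos: "p ^ e > 0" using k(2) by simp
  \<comment> \<open>Semilinear functionals are determined by their values on the basis. This serves
    both for injectivity of \<open>T\<close> and for the final identity.\<close>
  have agree: "h x = h' x"
    if "\<And>x y. h (x + y) = h x + h y" "\<And>c x. h (c ^ p ^ e * x) = c * h x"
      "\<And>x y. h' (x + y) = h' x + h' y" "\<And>c x. h' (c ^ p ^ e * x) = c * h' x"
      "\<And>b. b \<in> B \<Longrightarrow> h b = h' b" for h h' :: "'k \<Rightarrow> 'k" and x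
  proof -
    have "x \<in> span B" using B by auto
    then show ?thesis
    proof (induction rule: span_induct_alt)
      case base
      show ?case using that(2)[of 0 0] that(4)[of 0 0] by simp
    qed (use that in auto)
  qed
  \<comment> \<open>Scalars act through \<open>p ^ e\<close>-th powers, so the coordinates
    \<open>f (c * b)\<close> enter in this form. This makes \<open>T\<close> linear in
    \<open>c\<close>.\<close>
  define T where "T c = (\<Sum>b\<in>B. f (c * b) ^ p ^ e * b)" for c
  have coords: "\<forall>b\<in>B. u b = v b"
    if "(\<Sum>b\<in>B. u b ^ p ^ e * b) = (\<Sum>b\<in>B. v b ^ p ^ e * b)" for u v :: "'k \<Rightarrow> 'k"
  proof -
    have "(u b - v b) ^ p ^ e + v b ^ p ^ e = u b ^ p ^ e" for b
      by (simp flip: freshman_power[OF k(1,2)])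
    then have "(u b - v b) ^ p ^ e * b = u b ^ p ^ e * b - v b ^ p ^ e * b" for b
      by (metis add_diff_cancel_right' left_diff_distrib)
    then have "(\<Sum>b\<in>B. ?s (u b - v b) b) = 0"
      using that by (simp add: sum_subtractf)
    then have "\<forall>b\<in>B. u b - v b = 0"
      using independentD[OF B(1) fB subset_refl, of "\<lambda>b. u b - v b"] by blast
    then show ?thesis by simp
  qed
  have "Vector_Spaces.linear ?s ?s T"
  proof unfold_locales
    show "T (x + y) = T x + T y" for x y
      unfolding T_def distrib_right f1(1) freshman_power(1)[OF k(1,2)] sum.distrib ..
    show "T (?s c x) = ?s c (T x)" for c x
      unfolding T_def mult.assoc f1(2) power_mult_distrib sum_distrib_left ..
  qed
  moreover have "inj T"
  proof
    fix c d assume "T c = T d"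
    then have cd: "\<forall>b\<in>B. f (c * b) = f (d * b)"
      unfolding T_def by (rule coords)
    have eq: "f (c * x) = f (d * x)" for x
      by (rule agree) (simp_all only: cd distrib_left f1 mult.left_commute[of _ "_ ^ p ^ e"])
    show "c = d"
    proof (rule ccontr)
      assume "c \<noteq> d"
      \<comment> \<open>It follows that \<open>f\<close> vanishes on all multiples of the nonzero
        \<open>c - d\<close>, hence on the whole field, against
        \<open>f x0 \<noteq> 0\<close>.\<close>
      have "f ((c - d) * x) + f (d * x) = f (c * x)" for x
        by (simp only: left_diff_distrib diff_add_cancel flip: f1(1))
      then have "f ((c - d) * x) = 0" for x
        using eq by (metis add_cancel_left_left)
      then show False
        using nz \<open>c \<noteq> d\<close> by (metis eq_iff_diff_eq_0 nonzero_mult_div_cancel_left times_divide_eq_right)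
    qed
  qed
  \<comment> \<open>Finite dimension turns injectivity into surjectivity. A preimage of the element
    with coordinates \<open>g b\<close> is the required constant.\<close>
  ultimately have "surj T" by (rule linear_inj_imp_surj)
  then obtain c where "T c = (\<Sum>b\<in>B. g b ^ p ^ e * b)" by (metis surjD)
  then have c: "\<forall>b\<in>B. f (c * b) = g b"
    unfolding T_def by (rule coords)
  have "g x = f (c * x)" for x
    by (rule agree) (simp_all only: c distrib_left f1 g1 mult.left_commute[of _ "_ ^ p ^ e"])
  then show ?thesis by blast
qed

text \<open>Gaussian elimination, with functionals in place of coordinates.\<close>

lemma elimination:
  fixes comb :: "'g \<Rightarrow> 'g \<Rightarrow> 'k::field \<Rightarrow> 'g" and \<mu> :: "'j \<Rightarrow> 'g \<Rightarrow> 'k \<Rightarrow> 'k"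
  assumes "finite J"
    and twist: "\<And>f g x. f \<in> L \<Longrightarrow> g \<in> L \<Longrightarrow> f x \<noteq> 0 \<Longrightarrow> \<exists>c. \<forall>x. g x = f (c * x)"
    and comb: "\<And>u v c. u \<in> U \<Longrightarrow> v \<in> U \<Longrightarrow> comb u v c \<in> U"
    and cancel: "\<And>u v c. u \<in> U \<Longrightarrow> v \<in> U \<Longrightarrow> comb (comb u v (- c)) v c = u"
    and L: "\<And>j u. j \<in> J \<Longrightarrow> u \<in> U \<Longrightarrow> \<mu> j u \<in> L"
    and \<mu>_comb: "\<And>j u v c x. j \<in> J \<Longrightarrow> u \<in> U \<Longrightarrow> v \<in> U \<Longrightarrow> \<mu> j (comb u v c) x = \<mu> j u x + \<mu> j v (c * x)"
    and \<mu>_minus: "\<And>j u x. j \<in> J \<Longrightarrow> u \<in> U \<Longrightarrow> \<mu> j u (- x) = - \<mu> j u x"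
    and inj: "\<And>u. u \<in> U \<Longrightarrow> (\<And>j x. j \<in> J \<Longrightarrow> \<mu> j u x = 0) \<Longrightarrow> u = z"
  shows "\<exists>X\<subseteq>U. finite X \<and> card X \<le> card J \<and>
    (\<forall>H. z \<in> H \<longrightarrow> X \<subseteq> H \<longrightarrow> (\<forall>u\<in>H. \<forall>v\<in>X. \<forall>c. comb u v c \<in> H) \<longrightarrow> U \<subseteq> H)"
  using assms(1) comb cancel L \<mu>_comb \<mu>_minus inj
proof (induction J arbitrary: U)
  case empty
  then show ?case by (intro exI[of _ "{}"]) auto
next
  case (insert j J)
  note comb = insert.prems(1) and cancel = insert.prems(2) and L = insert.prems(3)
    and \<mu>_comb = insert.prems(4) and \<mu>_minus = insert.prems(5) and inj = insert.prems(6)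
  \<comment> \<open>The kernel of the functional with index \<open>j\<close>: an element of it
    killed by the remaining functionals is \<open>z\<close>, so the induction hypothesis applies
    with \<open>J\<close>.\<close>
  define U' where "U' = {u \<in> U. \<forall>x. \<mu> j u x = 0}"
  have "\<exists>X\<subseteq>U'. finite X \<and> card X \<le> card J \<and>
    (\<forall>H. z \<in> H \<longrightarrow> X \<subseteq> H \<longrightarrow> (\<forall>u\<in>H. \<forall>v\<in>X. \<forall>c. comb u v c \<in> H) \<longrightarrow> U' \<subseteq> H)"
  proof (rule insert.IH)
    show "comb u v c \<in> U'" if "u \<in> U'" "v \<in> U'" for u v c
      using that comb by (auto simp: U'_def \<mu>_comb)
    show "u = z" if "u \<in> U'" "\<And>j x. j \<in> J \<Longrightarrow> \<mu> j u x = 0" for u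
      using that by (intro inj) (auto simp: U'_def)
  qed (auto simp: U'_def cancel L \<mu>_comb \<mu>_minus)
  then obtain X where X: "X \<subseteq> U'" "finite X" "card X \<le> card J"
    and gen: "\<And>H. z \<in> H \<Longrightarrow> X \<subseteq> H \<Longrightarrow> (\<forall>u\<in>H. \<forall>v\<in>X. \<forall>c. comb u v c \<in> H) \<Longrightarrow> U' \<subseteq> H"
    by blast
  show ?case
  proof (cases "U \<subseteq> U'")
    case True
    then have "U' = U" by (auto simp: U'_def)
    then show ?thesis
      using X gen insert.hyps by (intro exI[of _ X]) auto
  next
    case False
    \<comment> \<open>The pivot: as its \<open>j\<close>-functional is nonzero, \<open>twist\<close>
      expresses the \<open>j\<close>-functional of any other element through it.\<close>
    then obtain u0 x0 where u0: "u0 \<in> U" "\<mu> j u0 x0 \<noteq> 0" by (auto simp: U'_def)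
    have "U \<subseteq> H" if H: "z \<in> H" "insert u0 X \<subseteq> H" "\<forall>u\<in>H. \<forall>v\<in>insert u0 X. \<forall>c. comb u v c \<in> H" for H
    proof
      fix u assume u: "u \<in> U"
      obtain c where c: "\<forall>x. \<mu> j u x = \<mu> j u0 (c * x)"
        using twist[of "\<mu> j u0" "\<mu> j u" x0] L u u0 by auto
      \<comment> \<open>Subtracting the multiple of the pivot lands in the kernel, which
        \<open>X\<close> generates; adding it back recovers \<open>u\<close> by
        \<open>cancel\<close>.\<close>
      have "comb u u0 (- c) \<in> U'"
        using u u0 comb c by (auto simp: U'_def \<mu>_comb \<mu>_minus)
      then have "comb u u0 (- c) \<in> H"
        using gen[of H] H by blast
      then show "u \<in> H"
        using H(3) cancel[OF u u0(1), of c] by (metis insertI1)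
    qed
    then show ?thesis
      using X u0 insert.hyps by (intro exI[of _ "insert u0 X"]) (auto simp: U'_def card_insert_if)
  qed
qed

section \<open>Gauges\<close>

lemma poly_mapping_sum_singles: "(\<Sum>\<alpha>\<in>Poly_Mapping.keys f. Poly_Mapping.single \<alpha> (Poly_Mapping.lookup f \<alpha>)) = f"
  by (rule poly_mapping_eqI) (auto simp: lookup_sum lookup_single when_def in_keys_iff sum.delta)

lemma single_power:
  "Poly_Mapping.single \<alpha> (c::'k::comm_semiring_1) ^ m = Poly_Mapping.single (\<Sum>i<m. \<alpha>) (c ^ m)"
  by (induction m) (auto simp: mult_single add.commute)

text \<open>Division with remainder in every exponent. The coefficient stays with the remainder
  because it need not have a \<open>q\<close>-th root.\<close>

lemma single_div_mod:
  "Poly_Mapping.single \<alpha> (x::'k::comm_semiring_1) =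
    Poly_Mapping.single (Poly_Mapping.map (\<lambda>t. t div q) \<alpha>) 1 ^ q
      * Poly_Mapping.single (Poly_Mapping.map (\<lambda>t. t mod q) \<alpha>) x"
proof -
  have "(\<Sum>i<q. Poly_Mapping.map (\<lambda>t. t div q) \<alpha>) + Poly_Mapping.map (\<lambda>t. t mod q) \<alpha> = \<alpha>"
    by (rule poly_mapping_eqI) (auto simp: lookup_add lookup_sum map.rep_eq when_def)
  then show ?thesis by (simp add: single_power mult_single)
qed

lemma bounded_monoms_inj: "inj_on (\<lambda>\<alpha>. restrict (Poly_Mapping.lookup \<alpha>) {..<n}) (bounded_monoms n d)"
proof (rule inj_onI, rule poly_mapping_eqI)
  fix \<alpha> \<beta> i
  assume *: "\<alpha> \<in> bounded_monoms n d" "\<beta> \<in> bounded_monoms n d"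
    "restrict (Poly_Mapping.lookup \<alpha>) {..<n} = restrict (Poly_Mapping.lookup \<beta>) {..<n}"
  show "Poly_Mapping.lookup \<alpha> i = Poly_Mapping.lookup \<beta> i"
  proof (cases "i < n")
    case True
    then show ?thesis using fun_cong[OF *(3), of i] by simp
  next
    case False
    then have "i \<notin> Poly_Mapping.keys \<alpha>" "i \<notin> Poly_Mapping.keys \<beta>"
      using * by (auto simp: bounded_monoms_def)
    then show ?thesis by (simp add: in_keys_iff)
  qed
qed

lemma bounded_monoms_image:
  "(\<lambda>\<alpha>. restrict (Poly_Mapping.lookup \<alpha>) {..<n}) ` bounded_monoms n d \<subseteq> (\<Pi>\<^sub>E i\<in>{..<n}. {..d})"
  by (intro image_subsetI PiE_I) (auto simp: bounded_monoms_def)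

lemma finite_bounded_monoms [simp]: "finite (bounded_monoms n d)"
  using finite_imageD[OF finite_subset[OF bounded_monoms_image finite_PiE] bounded_monoms_inj]
  by blast

lemma card_bounded_monoms_le: "card (bounded_monoms n d) \<le> Suc d ^ n"
proof -
  have "card (bounded_monoms n d) \<le> card (\<Pi>\<^sub>E i\<in>{..<n}. {..d})"
    using card_inj_on_le[OF bounded_monoms_inj bounded_monoms_image] by (simp add: finite_PiE)
  then show ?thesis by (simp add: card_PiE)
qed

text \<open>Replaces the choice of coefficients by a condition on supports, from which the closure
  properties of \<open>gauge_S\<close> follow.\<close>

lemma gauge_S_iff: "f \<in> gauge_S n d \<longleftrightarrow> Poly_Mapping.keys f \<subseteq> bounded_monoms n d"
proof
  assume "f \<in> gauge_S n d"
  then obtain c where f: "f = (\<Sum>\<alpha>\<in>bounded_monoms n d. Poly_Mapping.single \<alpha> (c \<alpha>))"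
    by (auto simp: gauge_S_def)
  show "Poly_Mapping.keys f \<subseteq> bounded_monoms n d"
    unfolding f using keys_sum by (fastforce split: if_splits)
next
  assume f: "Poly_Mapping.keys f \<subseteq> bounded_monoms n d"
  have "f = (\<Sum>\<alpha>\<in>bounded_monoms n d. Poly_Mapping.single \<alpha> (Poly_Mapping.lookup f \<alpha>))"
    using sum.mono_neutral_left[OF finite_bounded_monoms f, of "\<lambda>\<alpha>. Poly_Mapping.single \<alpha> (Poly_Mapping.lookup f \<alpha>)"]
    by (auto simp: poly_mapping_sum_singles in_keys_iff)
  then show "f \<in> gauge_S n d" by (auto simp: gauge_S_def)
qed

lemma gauge_S_add: "f \<in> gauge_S n d \<Longrightarrow> g \<in> gauge_S n d \<Longrightarrow> f + g \<in> gauge_S n d"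
  unfolding gauge_S_iff using keys_add[of f g] by blast

lemma gauge_S_zero: "0 \<in> gauge_S n d"
  by (simp add: gauge_S_iff)

lemma gauge_S_scale: "f \<in> gauge_S n d \<Longrightarrow> Poly_Mapping.single 0 c * f \<in> gauge_S n d"
  unfolding gauge_S_iff using keys_mult[of "Poly_Mapping.single 0 c" f] by (auto split: if_splits)

lemma gauge_S_diff: "f \<in> gauge_S n d \<Longrightarrow> g \<in> gauge_S n d \<Longrightarrow> f - g \<in> gauge_S n d"
  using gauge_S_add[of f n d "Poly_Mapping.single 0 (-1) * g"] gauge_S_scale[of g n d "-1"]
  by (simp add: single_uminus)

lemma gauge_S_mono: "d \<le> d' \<Longrightarrow> gauge_S n d \<subseteq> gauge_S n d'"
  unfolding subset_iff gauge_S_iff bounded_monoms_def by (auto intro: le_trans)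

section \<open>The polynomial ring as a commutative ring\<close>

lemma mpol_ring_simps [simp]:
  "f \<oplus>\<^bsub>mpol_ring n\<^esub> g = f + g" "f \<otimes>\<^bsub>mpol_ring n\<^esub> g = f * g"
  "\<zero>\<^bsub>mpol_ring n\<^esub> = 0" "\<one>\<^bsub>mpol_ring n\<^esub> = 1"
  by (simp_all add: mpol_ring_def)

lemma mpol_ring_carrier_iff:
  "f \<in> carrier (mpol_ring n) \<longleftrightarrow> (\<forall>\<alpha>\<in>Poly_Mapping.keys f. Poly_Mapping.keys \<alpha> \<subseteq> {..<n})"
  by (simp add: mpol_ring_def)

lemma mpol_ring_pow [simp]: "f [^]\<^bsub>mpol_ring n\<^esub> (m::nat) = f ^ m"
  by (induction m) (auto simp: nat_pow_def mpol_ring_def mult.commute)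

lemma mpol_ring_mult_closed:
  assumes "f \<in> carrier (mpol_ring n)" "g \<in> carrier (mpol_ring n)"
  shows "f * g \<in> carrier (mpol_ring n)"
  unfolding mpol_ring_carrier_iff
proof
  fix \<gamma> assume "\<gamma> \<in> Poly_Mapping.keys (f * g)"
  then obtain \<alpha> \<beta> where "\<alpha> \<in> Poly_Mapping.keys f" "\<beta> \<in> Poly_Mapping.keys g" "\<gamma> = \<alpha> + \<beta>"
    using keys_mult[of f g] by blast
  then show "Poly_Mapping.keys \<gamma> \<subseteq> {..<n}"
    using assms keys_add[of \<alpha> \<beta>] unfolding mpol_ring_carrier_iff by blast
qed

lemma mpol_ring_add_closed:
  "f \<in> carrier (mpol_ring n) \<Longrightarrow> g \<in> carrier (mpol_ring n) \<Longrightarrow> f + g \<in> carrier (mpol_ring n)"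
  unfolding mpol_ring_carrier_iff using keys_add[of f g] by blast

lemma mpol_ring_zero_one_closed: "0 \<in> carrier (mpol_ring n)" "1 \<in> carrier (mpol_ring n)"
  by (auto simp: mpol_ring_carrier_iff)

lemma cring_mpol_ring: "cring (mpol_ring n)"
proof (intro cringI abelian_groupI comm_monoidI)
  fix f :: "'a mpol" assume "f \<in> carrier (mpol_ring n)"
  then have "- f \<in> carrier (mpol_ring n)"
    by (auto simp: mpol_ring_carrier_iff in_keys_iff)
  then show "\<exists>g\<in>carrier (mpol_ring n). g \<oplus>\<^bsub>mpol_ring n\<^esub> f = \<zero>\<^bsub>mpol_ring n\<^esub>"
    by (intro bexI[of _ "- f"]) auto
qed (auto simp: mpol_ring_mult_closed mpol_ring_add_closed algebra_simps mpol_ring_zero_one_closed)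

lemma gauge_S_carrier: "f \<in> gauge_S n d \<Longrightarrow> f \<in> carrier (mpol_ring n)"
  by (auto simp: gauge_S_iff mpol_ring_carrier_iff bounded_monoms_def)

lemma mpol_ring_carrier_gauge_S:
  assumes "f \<in> carrier (mpol_ring n)"
  shows "\<exists>d. f \<in> gauge_S n d"
proof -
  let ?A = "(\<Union>\<alpha>\<in>Poly_Mapping.keys f. Poly_Mapping.lookup \<alpha> ` {..<n})"
  have "Poly_Mapping.lookup \<alpha> i \<le> Max ?A" if "\<alpha> \<in> Poly_Mapping.keys f" "i < n" for \<alpha> i
    using that by (intro Max_ge) auto
  \<comment> \<open>For empty \<open>?A\<close> the value of \<open>Max\<close> is unspecified, but
    then there is no exponent to bound.\<close>
  then have "f \<in> gauge_S n (Max ?A)"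
    using assms unfolding gauge_S_iff mpol_ring_carrier_iff bounded_monoms_def by blast
  then show ?thesis ..
qed

lemma single_carrier_iff:
  "Poly_Mapping.keys \<alpha> \<subseteq> {..<n} \<Longrightarrow> Poly_Mapping.single \<alpha> c \<in> carrier (mpol_ring n)"
  by (simp add: mpol_ring_carrier_iff)

lemma lookup_scale: "Poly_Mapping.lookup (Poly_Mapping.single 0 c * f) \<beta> = (c::'k::field) * Poly_Mapping.lookup f \<beta>"
  by (auto simp: map.rep_eq when_def simp flip: mult_map_scale_conv_mult)

section \<open>The quotient ring and its gauge filtration\<close>

locale mpol_quotient = ideal I "mpol_ring n" for n :: nat and I :: "'k::field mpol set"
begin

abbreviation Q where "Q \<equiv> mpol_ring n Quot I"
abbreviation coset where "coset f \<equiv> I +>\<^bsub>mpol_ring n\<^esub> f"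

sublocale Q: cring Q
  by (rule quotient_is_cring[OF cring_mpol_ring])

lemma coset_closed: "f \<in> carrier (mpol_ring n) \<Longrightarrow> coset f \<in> carrier Q"
  using ring_hom_closed[OF rcos_ring_hom] .

lemma coset_add:
  "f \<in> carrier (mpol_ring n) \<Longrightarrow> g \<in> carrier (mpol_ring n) \<Longrightarrow> coset f \<oplus>\<^bsub>Q\<^esub> coset g = coset (f + g)"
  using ring_hom_add[OF rcos_ring_hom] by simp

lemma coset_mult:
  "f \<in> carrier (mpol_ring n) \<Longrightarrow> g \<in> carrier (mpol_ring n) \<Longrightarrow> coset f \<otimes>\<^bsub>Q\<^esub> coset g = coset (f * g)"
  using ring_hom_mult[OF rcos_ring_hom] by simp

lemma coset_pow:
  assumes "f \<in> carrier (mpol_ring n)" shows "coset f [^]\<^bsub>Q\<^esub> (m::nat) = coset (f ^ m)"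
  using ring_hom_ring.hom_nat_pow[OF rcos_ring_hom_ring] assms by simp

lemma coset_zero: "coset 0 = \<zero>\<^bsub>Q\<^esub>"
  using ring_hom_zero[OF rcos_ring_hom ring_axioms Q.ring_axioms] by simp

lemma coset_surj: "r \<in> carrier Q \<Longrightarrow> \<exists>f\<in>carrier (mpol_ring n). r = coset f"
  by (auto simp: FactRing_def A_RCOSETS_def' a_r_coset_def)

lemma coset_eq_zero_iff: "f \<in> carrier (mpol_ring n) \<Longrightarrow> coset f = \<zero>\<^bsub>Q\<^esub> \<longleftrightarrow> f \<in> I"
  using a_rcos_zero[OF is_ideal] rcos_const_imp_mem by (auto simp: FactRing_def)

lemma coset_eqD:
  assumes "f \<in> gauge_S n d" "g \<in> gauge_S n d" "coset f = coset g"
  shows "f - g \<in> I"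
proof -
  have c: "f - g \<in> carrier (mpol_ring n)" "g \<in> carrier (mpol_ring n)"
    using assms gauge_S_carrier gauge_S_diff by blast+
  then have "coset (f - g) \<oplus>\<^bsub>Q\<^esub> coset g = coset g"
    using coset_add assms(3) by simp
  then have "coset (f - g) = \<zero>\<^bsub>Q\<^esub>"
    using c coset_closed by simp
  then show ?thesis using coset_eq_zero_iff c by blast
qed

lemma gauge_R_nat: "gauge_R n I (int d) = coset ` gauge_S n d"
  by (simp add: gauge_R_def)

lemma zero_in_gauge_R: "\<zero>\<^bsub>Q\<^esub> \<in> gauge_R n I d"
  by (auto simp: gauge_R_def gauge_S_zero simp flip: coset_zero)

lemma gauge_R_mono: "d \<le> d' \<Longrightarrow> gauge_R n I d \<subseteq> gauge_R n I d'"
  using zero_in_gauge_R[of d'] image_mono[OF gauge_S_mono[of "nat d" "nat d'" n], of coset]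
  by (auto simp: gauge_R_def)

lemma gauge_R_add:
  assumes "r \<in> gauge_R n I (int d)" "s \<in> gauge_R n I (int d)"
  shows "r \<oplus>\<^bsub>Q\<^esub> s \<in> gauge_R n I (int d)"
proof -
  obtain f g where "f \<in> gauge_S n d" "r = coset f" "g \<in> gauge_S n d" "s = coset g"
    using assms by (auto simp: gauge_R_nat)
  then show ?thesis
    by (auto simp: gauge_R_nat coset_add gauge_S_carrier intro: gauge_S_add)
qed

text \<open>The \<open>R_d\<close> increase, exhaust \<open>R\<close> and are 0 for
  \<open>d < 0\<close>. A nonzero element therefore enters at exactly one index, so the definite
  description in \<open>gauge\<close> is well defined.\<close>

lemma gauge_le_iff:
  assumes r: "r \<in> carrier Q"
  shows "gauge n I r \<le> ereal (real d) \<longleftrightarrow> r \<in> gauge_R n I (int d)"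
proof (cases "r = \<zero>\<^bsub>Q\<^esub>")
  case True
  then show ?thesis using zero_in_gauge_R by (simp add: gauge_def)
next
  case False
  obtain f where f: "f \<in> carrier (mpol_ring n)" "r = coset f" using coset_surj r by blast
  obtain d1 where "f \<in> gauge_S n d1" using mpol_ring_carrier_gauge_S f by blast
  then have d1: "r \<in> gauge_R n I (int d1)" using f by (auto simp: gauge_R_nat)
  define m where "m = (LEAST m. r \<in> gauge_R n I (int m))"
  have m: "r \<in> gauge_R n I (int m)" unfolding m_def using d1 by (rule LeastI)
  have m_le: "m \<le> k" if "r \<in> gauge_R n I (int k)" for k
    unfolding m_def using that by (rule Least_le)
  have neg: "r \<notin> gauge_R n I k" if "k < 0" for k
    using that False by (simp add: gauge_R_def)
  have iff: "r \<in> gauge_R n I k \<longleftrightarrow> int m \<le> k" for k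
  proof
    assume "r \<in> gauge_R n I k"
    moreover from this have "k \<ge> 0" using neg by force
    ultimately show "int m \<le> k" using m_le[of "nat k"] by simp
  qed (use m gauge_R_mono in blast)
  have "(THE k. r \<in> gauge_R n I k - gauge_R n I (k - 1)) = int m"
    by (rule the_equality) (auto simp: iff)
  then show ?thesis
    using False iff by (simp add: gauge_def)
qed

text \<open>A \<open>k\<close>-linear section of the projection onto \<open>R\<^sub>d\<close> comes from a linear projection
  of the polynomial ring onto the intersection of \<open>I\<close> and \<open>S\<^sub>d\<close>.\<close>

lemma linear_section:
  obtains \<sigma> where
    "\<And>r. r \<in> gauge_R n I (int d) \<Longrightarrow> \<sigma> r \<in> gauge_S n d \<and> coset (\<sigma> r) = r"
    "\<And>r s. r \<in> gauge_R n I (int d) \<Longrightarrow> s \<in> gauge_R n I (int d) \<Longrightarrow> \<sigma> (r \<oplus>\<^bsub>Q\<^esub> s) = \<sigma> r + \<sigma> s"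
    "\<And>r c. r \<in> gauge_R n I (int d) \<Longrightarrow>
      \<sigma> (coset (Poly_Mapping.single 0 c) \<otimes>\<^bsub>Q\<^esub> r) = Poly_Mapping.single 0 c * \<sigma> r"
proof -
  let ?s = "\<lambda>(c::'k) f. Poly_Mapping.single 0 c * f :: 'k mpol"
  interpret V: vector_space ?s
    by unfold_locales (auto simp: algebra_simps single_add mult_single simp flip: mult.assoc)
  interpret VV: vector_space_pair ?s ?s ..
  have const: "Poly_Mapping.single 0 c \<in> carrier (mpol_ring n)" for c :: 'k
    by (simp add: mpol_ring_carrier_iff)
  let ?V = "I \<inter> gauge_S n d"
  have V: "V.subspace ?V"
  proof (rule V.subspaceI)
    show "0 \<in> ?V" using additive_subgroup.zero_closed[OF is_additive_subgroup] gauge_S_zero by simp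
    show "x + y \<in> ?V" if "x \<in> ?V" "y \<in> ?V" for x y
      using that additive_subgroup.a_closed[OF is_additive_subgroup, of x y] by (simp add: gauge_S_add)
    show "?s c x \<in> ?V" if "x \<in> ?V" for c x
      using that I_l_closed[of x "Poly_Mapping.single 0 c"] const by (simp add: gauge_S_scale)
  qed
  \<comment> \<open>A linear left inverse of the inclusion of \<open>?V\<close>, that is, a
    projection of the polynomials onto \<open>?V\<close>.\<close>
  obtain P where P: "range P \<subseteq> ?V" "Vector_Spaces.linear ?s ?s P" "\<And>v. v \<in> ?V \<Longrightarrow> P v = v"
    using VV.linear_exists_left_inverse_on[OF V.linear_id V] by auto
  have P_add: "P (f + g) = P f + P g" and P_scale: "P (?s c f) = ?s c (P f)" for f g c
    using P(2) by (auto simp: VV.linear_add VV.linear_scale)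
  have P_diff: "P (f - g) = P f - P g" for f g
    using P_add[of "f - g" g] by simp
  have P_S: "P f \<in> gauge_S n d" and P_I: "P f \<in> I" for f
    using P(1) by auto
  define \<sigma> where "\<sigma> r = (let f = (SOME f. f \<in> gauge_S n d \<and> r = coset f) in f - P f)" for r
  \<comment> \<open>Independence of the representative: two representatives in \<open>S_d\<close>
    differ by an element of \<open>?V\<close>, which \<open>P\<close> fixes.\<close>
  have \<sigma>: "\<sigma> (coset f) = f - P f" if f: "f \<in> gauge_S n d" for f
  proof -
    define g where "g = (SOME g. g \<in> gauge_S n d \<and> coset f = coset g)"
    have g: "g \<in> gauge_S n d \<and> coset f = coset g"
      unfolding g_def using f by (intro someI_ex[of "\<lambda>g. g \<in> gauge_S n d \<and> coset f = coset g"]) blast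
    then have "P (f - g) = f - g"
      using coset_eqD gauge_S_diff f by (intro P(3)) blast
    then have "f - P f = g - P g" by (simp add: P_diff algebra_simps)
    then show ?thesis unfolding \<sigma>_def g_def Let_def by simp
  qed
  show ?thesis
  proof
    fix r assume "r \<in> gauge_R n I (int d)"
    then obtain f where f: "f \<in> gauge_S n d" "r = coset f" by (auto simp: gauge_R_nat)
    have "coset (f - P f) \<oplus>\<^bsub>Q\<^esub> coset (P f) = coset f"
      using coset_add gauge_S_carrier gauge_S_diff P_S f by (metis diff_add_cancel)
    moreover have "coset (P f) = \<zero>\<^bsub>Q\<^esub>"
      using coset_eq_zero_iff P_I gauge_S_carrier P_S by blast
    moreover have "coset (f - P f) \<in> carrier Q"
      using coset_closed gauge_S_carrier gauge_S_diff P_S f by blast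
    ultimately show "\<sigma> r \<in> gauge_S n d \<and> coset (\<sigma> r) = r"
      using f by (simp add: \<sigma> gauge_S_diff P_S)
    show "\<sigma> (coset (Poly_Mapping.single 0 c) \<otimes>\<^bsub>Q\<^esub> r) = Poly_Mapping.single 0 c * \<sigma> r" for c
      unfolding f(2) coset_mult[OF const gauge_S_carrier[OF f(1)]] \<sigma>[OF f(1)] \<sigma>[OF gauge_S_scale[OF f(1)]]
      by (simp add: P_scale right_diff_distrib)
    fix s assume "s \<in> gauge_R n I (int d)"
    then obtain g where g: "g \<in> gauge_S n d" "s = coset g" by (auto simp: gauge_R_nat)
    show "\<sigma> (r \<oplus>\<^bsub>Q\<^esub> s) = \<sigma> r + \<sigma> s"
      unfolding f(2) g(2) coset_add[OF gauge_S_carrier[OF f(1)] gauge_S_carrier[OF g(1)]]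
        \<sigma>[OF f(1)] \<sigma>[OF g(1)] \<sigma>[OF gauge_S_add[OF f(1) g(1)]] P_add by simp
  qed
qed

section \<open>Cartier maps on the quotient and their gauge bounds\<close>

lemma coset_scale:
  "Poly_Mapping.keys \<alpha> \<subseteq> {..<n} \<Longrightarrow>
    coset (Poly_Mapping.single 0 c) \<otimes>\<^bsub>Q\<^esub> coset (Poly_Mapping.single \<alpha> x) = coset (Poly_Mapping.single \<alpha> (c * x))"
  by (simp add: coset_mult single_carrier_iff mult_single)

text \<open>Each term of a polynomial is a \<open>p ^ e\<close>-th power times a term with exponents
  below \<open>p ^ e\<close>. Semilinearity pulls the power out, and additivity passes to
  sums.\<close>

lemma cartier_maps_eq_zero:
  assumes \<phi>: "\<phi> \<in> cartier_maps Q p e" and p: "p > 0"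
    and zero: "\<And>\<alpha> x. \<alpha> \<in> bounded_monoms n (p ^ e - 1) \<Longrightarrow> \<phi> (coset (Poly_Mapping.single \<alpha> x)) = \<zero>\<^bsub>Q\<^esub>"
    and r: "r \<in> carrier Q"
  shows "\<phi> r = \<zero>\<^bsub>Q\<^esub>"
proof -
  have single: "\<phi> (coset (Poly_Mapping.single \<alpha> x)) = \<zero>\<^bsub>Q\<^esub>" if \<alpha>: "Poly_Mapping.keys \<alpha> \<subseteq> {..<n}" for \<alpha> x
  proof -
    let ?q = "p ^ e"
    define \<beta> where "\<beta> = Poly_Mapping.map (\<lambda>t. t div ?q) \<alpha>"
    define \<gamma> where "\<gamma> = Poly_Mapping.map (\<lambda>t. t mod ?q) \<alpha>"
    have keys: "Poly_Mapping.keys \<beta> \<subseteq> {..<n}" "Poly_Mapping.keys \<gamma> \<subseteq> {..<n}"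
      using \<alpha> by (auto simp: \<beta>_def \<gamma>_def map.rep_eq in_keys_iff when_def subset_iff split: if_splits)
    have "t mod ?q \<le> ?q - 1" for t
    proof -
      have "t mod ?q < ?q" using p by simp
      then show ?thesis by linarith
    qed
    then have \<gamma>: "\<gamma> \<in> bounded_monoms n (?q - 1)"
      using keys by (auto simp: bounded_monoms_def \<gamma>_def map.rep_eq when_def)
    have m: "Poly_Mapping.single \<beta> (1::'k) \<in> carrier (mpol_ring n)" "Poly_Mapping.single \<gamma> x \<in> carrier (mpol_ring n)"
      using keys single_carrier_iff by blast+
    have "coset (Poly_Mapping.single \<alpha> x) =
        coset (Poly_Mapping.single \<beta> 1) [^]\<^bsub>Q\<^esub> ?q \<otimes>\<^bsub>Q\<^esub> coset (Poly_Mapping.single \<gamma> x)"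
      using m nat_pow_closed[OF m(1), of ?q]
      by (simp add: coset_pow coset_mult \<beta>_def \<gamma>_def flip: single_div_mod)
    then show ?thesis
      using Q.cartier_maps_semilinear[OF \<phi> coset_closed[OF m(1)] coset_closed[OF m(2)]] zero[OF \<gamma>]
        coset_closed[OF m(1)] by simp
  qed
  obtain f where f: "f \<in> carrier (mpol_ring n)" "r = coset f" using coset_surj r by blast
  have "(\<Sum>\<alpha>\<in>A. Poly_Mapping.single \<alpha> (Poly_Mapping.lookup f \<alpha>)) \<in> carrier (mpol_ring n) \<and>
      \<phi> (coset (\<Sum>\<alpha>\<in>A. Poly_Mapping.single \<alpha> (Poly_Mapping.lookup f \<alpha>))) = \<zero>\<^bsub>Q\<^esub>"
    if "finite A" "\<forall>\<alpha>\<in>A. Poly_Mapping.keys \<alpha> \<subseteq> {..<n}" for A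
    using that
  proof (induction A)
    case empty
    then show ?case
      using coset_zero Q.cartier_maps_zero[OF \<phi>] by (simp add: mpol_ring_zero_one_closed)
  next
    case (insert \<alpha> A)
    let ?m = "Poly_Mapping.single \<alpha> (Poly_Mapping.lookup f \<alpha>)"
    let ?g = "\<Sum>\<alpha>\<in>A. Poly_Mapping.single \<alpha> (Poly_Mapping.lookup f \<alpha>)"
    have m: "?m \<in> carrier (mpol_ring n)" using insert single_carrier_iff by blast
    have g: "?g \<in> carrier (mpol_ring n)" "\<phi> (coset ?g) = \<zero>\<^bsub>Q\<^esub>" using insert by auto
    have "\<phi> (coset ?m \<oplus>\<^bsub>Q\<^esub> coset ?g) = \<phi> (coset ?m) \<oplus>\<^bsub>Q\<^esub> \<phi> (coset ?g)"
      using Q.cartier_maps_add[OF \<phi>] m g coset_closed by blast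
    then show ?case
      using insert.hyps insert.prems m g single by (simp add: coset_add mpol_ring_add_closed)
  qed
  from this[of "Poly_Mapping.keys f"] show ?thesis
    using f by (simp add: poly_mapping_sum_singles mpol_ring_carrier_iff)
qed

text \<open>As \<open>R\<^sub>d\<close> is closed under addition, the condition says that \<open>\<Phi> e\<close> maps \<open>R\<^bsub>p^e-1\<^esub>\<close> into \<open>R\<^sub>d\<close>.\<close>

definition gauge_part ::
    "nat \<Rightarrow> (nat \<Rightarrow> 'k mpol set \<Rightarrow> 'k mpol set) set \<Rightarrow> nat \<Rightarrow> nat \<Rightarrow> (nat \<Rightarrow> 'k mpol set \<Rightarrow> 'k mpol set) set" where
  "gauge_part p D d e = {\<Phi> \<in> degree_part Q D e. \<forall>\<alpha>\<in>bounded_monoms n (p ^ e - 1). \<forall>x.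
    \<Phi> e (coset (Poly_Mapping.single \<alpha> x)) \<in> gauge_R n I (int d)}"

text \<open>The dimension count: elimination is applied to coordinate functionals indexed by a
  source monomial and a target monomial. It uses right multiples by constants from \<open>k\<close>,
  which are special right multiples by elements of \<open>R\<close>.\<close>

lemma gauge_part_generators:
  assumes k: "CHAR('k) = p" "p > 0" "F_finite_field TYPE('k)"
    and D: "cartier_subalgebra Q p D"
  shows "\<exists>X\<subseteq>gauge_part p D d e. finite X \<and> card X \<le> Suc d ^ n * (p ^ n) ^ e \<and>
    (\<forall>H. \<zero>\<^bsub>cartier_algebra Q p\<^esub> \<in> H \<longrightarrow> X \<subseteq> H \<longrightarrow>
      (\<forall>\<Phi>\<in>H. \<forall>\<Psi>\<in>X. \<forall>r\<in>carrier Q.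
        \<Phi> \<oplus>\<^bsub>cartier_algebra Q p\<^esub> (\<Psi> \<otimes>\<^bsub>cartier_algebra Q p\<^esub> scalar Q r) \<in> H) \<longrightarrow>
      gauge_part p D d e \<subseteq> H)"
proof -
  let ?C = "cartier_algebra Q p" and ?U = "gauge_part p D d e"
  let ?q = "p ^ e"
  let ?B = "bounded_monoms n (?q - 1)"
  let ?m = "\<lambda>\<alpha> x. coset (Poly_Mapping.single \<alpha> x)"
  note DD = Q.cartier_subalgebra_props[OF D]
  define comb where "comb \<Phi> \<Psi> c = \<Phi> \<oplus>\<^bsub>?C\<^esub> (\<Psi> \<otimes>\<^bsub>?C\<^esub> scalar Q (?m 0 c))" for \<Phi> \<Psi> c
  obtain \<sigma> where \<sigma>: "\<And>r. r \<in> gauge_R n I (int d) \<Longrightarrow> \<sigma> r \<in> gauge_S n d \<and> coset (\<sigma> r) = r"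
    and \<sigma>_add: "\<And>r s. r \<in> gauge_R n I (int d) \<Longrightarrow> s \<in> gauge_R n I (int d) \<Longrightarrow> \<sigma> (r \<oplus>\<^bsub>Q\<^esub> s) = \<sigma> r + \<sigma> s"
    and \<sigma>_scale: "\<And>r c. r \<in> gauge_R n I (int d) \<Longrightarrow> \<sigma> (?m 0 c \<otimes>\<^bsub>Q\<^esub> r) = Poly_Mapping.single 0 c * \<sigma> r"
    using linear_section by metis
  \<comment> \<open>Separate the values of \<open>\<Phi>\<close> on each line \<open>k x\<^sup>\<alpha>\<close> into coordinates; each of these coordinate
    functions lies in \<open>Hom\<^sub>k(F\<^sup>e\<^sub>*k, k)\<close>, and jointly they determine \<open>\<Phi>\<close>.\<close>
  define \<mu> where "\<mu> j \<Phi> x = Poly_Mapping.lookup (\<sigma> (\<Phi> e (?m (fst j) x))) (snd j)"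
    for j :: "(nat \<Rightarrow>\<^sub>0 nat) \<times> (nat \<Rightarrow>\<^sub>0 nat)" and \<Phi> :: "nat \<Rightarrow> 'k mpol set \<Rightarrow> 'k mpol set" and x :: 'k
  define J where "J = ?B \<times> bounded_monoms n d"
  have keys: "Poly_Mapping.keys \<alpha> \<subseteq> {..<n}" if "\<alpha> \<in> ?B" for \<alpha>
    using that by (auto simp: bounded_monoms_def)
  have m_closed: "?m \<alpha> x \<in> carrier Q" if "Poly_Mapping.keys \<alpha> \<subseteq> {..<n}" for \<alpha> x
    using that coset_closed single_carrier_iff by blast
  have m0: "?m 0 c \<in> carrier Q" for c
    by (rule m_closed) simp
  have U_carrier: "\<Phi> \<in> carrier ?C" "\<Phi> \<in> degree_part Q D e" if "\<Phi> \<in> ?U" for \<Phi>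
    using that DD(1) by (auto simp: gauge_part_def degree_part_def)
  have U_map: "\<Phi> i \<in> cartier_maps Q p i" if "\<Phi> \<in> ?U" for \<Phi> i
    using Q.cartier_algebra_carrierD[OF U_carrier(1)[OF that]] .
  have U_gauge: "\<Phi> e (?m \<alpha> x) \<in> gauge_R n I (int d)" if "\<Phi> \<in> ?U" "\<alpha> \<in> ?B" for \<Phi> \<alpha> x
    using that by (auto simp: gauge_part_def)
  have comb_apply: "comb \<Phi> \<Psi> c i s = \<Phi> i s \<oplus>\<^bsub>Q\<^esub> \<Psi> i (?m 0 c \<otimes>\<^bsub>Q\<^esub> s)"
    if "\<Psi> \<in> carrier ?C" "s \<in> carrier Q" for \<Phi> \<Psi> c i s
    using that m0 by (simp add: comb_def Q.cartier_algebra_add_apply Q.cartier_algebra_mult_scalar)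
  have comb_e: "comb \<Phi> \<Psi> c e (?m \<alpha> x) = \<Phi> e (?m \<alpha> x) \<oplus>\<^bsub>Q\<^esub> \<Psi> e (?m \<alpha> (c * x))"
    if "\<Psi> \<in> ?U" "\<alpha> \<in> ?B" for \<Phi> \<Psi> c \<alpha> x
    using comb_apply[OF U_carrier(1)[OF that(1)] m_closed[OF keys[OF that(2)]]]
      coset_scale[OF keys[OF that(2)]] by simp
  have comb_closed: "comb \<Phi> \<Psi> c \<in> ?U" if "\<Phi> \<in> ?U" "\<Psi> \<in> ?U" for \<Phi> \<Psi> c
  proof -
    have "comb \<Phi> \<Psi> c \<in> degree_part Q D e"
      unfolding comb_def
      by (intro Q.degree_part_add[OF D] Q.degree_part_mult_scalar[OF D] U_carrier m0 that)
    moreover have "comb \<Phi> \<Psi> c e (?m \<alpha> x) \<in> gauge_R n I (int d)" if "\<alpha> \<in> ?B" for \<alpha> x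
      unfolding comb_e[OF \<open>\<Psi> \<in> ?U\<close> that]
      by (intro gauge_R_add U_gauge \<open>\<Phi> \<in> ?U\<close> \<open>\<Psi> \<in> ?U\<close> that)
    ultimately show ?thesis by (simp add: gauge_part_def)
  qed
  have \<mu>_L: "\<mu> j \<Phi> \<in> root_linear ?q" if "j \<in> J" "\<Phi> \<in> ?U" for j \<Phi>
  proof -
    obtain \<alpha> \<beta> where j: "j = (\<alpha>, \<beta>)" "\<alpha> \<in> ?B"
      using \<open>j \<in> J\<close> unfolding J_def by blast
    have "\<mu> j \<Phi> (x + y) = \<mu> j \<Phi> x + \<mu> j \<Phi> y" for x y
    proof -
      have "?m \<alpha> (x + y) = ?m \<alpha> x \<oplus>\<^bsub>Q\<^esub> ?m \<alpha> y"
        using keys[OF j(2)] by (simp add: coset_add single_carrier_iff single_add)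
      then show ?thesis
        using j that keys m_closed U_gauge
        by (simp add: \<mu>_def Q.cartier_maps_add[OF U_map] \<sigma>_add lookup_add)
    qed
    moreover have "\<mu> j \<Phi> (c ^ ?q * x) = c * \<mu> j \<Phi> x" for c x
    proof -
      \<comment> \<open>Constants of \<open>k\<close> are elements of \<open>R\<close>, so
        semilinearity over \<open>R\<close> gives \<open>c ^ ?q\<close> on the source and
        \<open>c\<close> on the target.\<close>
      have "?m 0 c [^]\<^bsub>Q\<^esub> ?q = ?m 0 (c ^ ?q)"
        by (simp add: coset_pow single_carrier_iff single_power)
      then have "?m \<alpha> (c ^ ?q * x) = ?m 0 c [^]\<^bsub>Q\<^esub> ?q \<otimes>\<^bsub>Q\<^esub> ?m \<alpha> x"
        using coset_scale[OF keys[OF j(2)]] by simp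
      then have "\<Phi> e (?m \<alpha> (c ^ ?q * x)) = ?m 0 c \<otimes>\<^bsub>Q\<^esub> \<Phi> e (?m \<alpha> x)"
        using Q.cartier_maps_semilinear[OF U_map[OF that(2)] m0 m_closed[OF keys[OF j(2)]]] by simp
      then show ?thesis
        using j by (simp add: \<mu>_def \<sigma>_scale[OF U_gauge[OF that(2) j(2)]] lookup_scale)
    qed
    ultimately show ?thesis by (simp add: root_linear_def)
  qed
  have "\<exists>X\<subseteq>?U. finite X \<and> card X \<le> card J \<and>
    (\<forall>H. \<zero>\<^bsub>?C\<^esub> \<in> H \<longrightarrow> X \<subseteq> H \<longrightarrow> (\<forall>u\<in>H. \<forall>v\<in>X. \<forall>c. comb u v c \<in> H) \<longrightarrow> ?U \<subseteq> H)"
  proof (rule elimination[where L = "root_linear ?q" and \<mu> = \<mu>])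
    show "finite J" by (simp add: J_def)
    show "\<exists>c. \<forall>x. g x = f (c * x)" if "f \<in> root_linear ?q" "g \<in> root_linear ?q" "f x \<noteq> 0" for f g and x :: 'k
      using root_linear_twist[OF k that] .
    show "comb \<Phi> \<Psi> c \<in> ?U" if "\<Phi> \<in> ?U" "\<Psi> \<in> ?U" for \<Phi> \<Psi> c
      using comb_closed that .
    show "\<mu> j \<Phi> \<in> root_linear ?q" if "j \<in> J" "\<Phi> \<in> ?U" for j \<Phi>
      using \<mu>_L that .
    show "\<mu> j \<Phi> (- x) = - \<mu> j \<Phi> x" if "j \<in> J" "\<Phi> \<in> ?U" for j \<Phi> x
      using root_linear_minus[OF \<mu>_L[OF that]] .
    show "\<mu> j (comb \<Phi> \<Psi> c) x = \<mu> j \<Phi> x + \<mu> j \<Psi> (c * x)" if "j \<in> J" "\<Phi> \<in> ?U" "\<Psi> \<in> ?U" for j \<Phi> \<Psi> c x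
      using that U_gauge by (auto simp: \<mu>_def comb_e \<sigma>_add lookup_add J_def)
    show "comb (comb \<Phi> \<Psi> (- c)) \<Psi> c = \<Phi>" if U: "\<Phi> \<in> ?U" "\<Psi> \<in> ?U" for \<Phi> \<Psi> c
    proof (rule Q.cartier_algebra_eqI)
      show "comb (comb \<Phi> \<Psi> (- c)) \<Psi> c \<in> carrier ?C" "\<Phi> \<in> carrier ?C"
        by (intro U_carrier(1) comb_closed U)+
      fix i s assume s: "s \<in> carrier Q"
      have ms: "?m 0 b \<otimes>\<^bsub>Q\<^esub> s \<in> carrier Q" for b using m0 s by simp
      \<comment> \<open>The two added right multiples of \<Psi> cancel, since \<Psi> is additive and
        \<open>- c\<close> and \<open>c\<close> sum to 0.\<close>
      have "?m 0 (- c) \<oplus>\<^bsub>Q\<^esub> ?m 0 c = \<zero>\<^bsub>Q\<^esub>"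
        by (simp add: coset_add single_carrier_iff coset_zero flip: single_add)
      then have "(?m 0 (- c) \<otimes>\<^bsub>Q\<^esub> s) \<oplus>\<^bsub>Q\<^esub> (?m 0 c \<otimes>\<^bsub>Q\<^esub> s) = \<zero>\<^bsub>Q\<^esub>"
        using m0 s by (simp flip: Q.l_distr)
      then have "\<Psi> i (?m 0 (- c) \<otimes>\<^bsub>Q\<^esub> s) \<oplus>\<^bsub>Q\<^esub> \<Psi> i (?m 0 c \<otimes>\<^bsub>Q\<^esub> s) = \<zero>\<^bsub>Q\<^esub>"
        using Q.cartier_maps_zero[OF U_map[OF U(2)]]
        by (simp add: ms flip: Q.cartier_maps_add[OF U_map[OF U(2)]])
      then show "comb (comb \<Phi> \<Psi> (- c)) \<Psi> c i s = \<Phi> i s"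
        using U s ms Q.cartier_maps_closed[OF U_map]
        by (simp add: comb_apply U_carrier Q.a_assoc)
    qed
    show "\<Phi> = \<zero>\<^bsub>?C\<^esub>" if U: "\<Phi> \<in> ?U" and zero: "\<And>j x. j \<in> J \<Longrightarrow> \<mu> j \<Phi> x = 0" for \<Phi>
    proof -
      have "\<Phi> e (?m \<alpha> x) = \<zero>\<^bsub>Q\<^esub>" if \<alpha>: "\<alpha> \<in> ?B" for \<alpha> x
      proof -
        let ?f = "\<sigma> (\<Phi> e (?m \<alpha> x))"
        have f: "?f \<in> gauge_S n d" "coset ?f = \<Phi> e (?m \<alpha> x)"
          using \<sigma> U_gauge[OF U \<alpha>] by auto
        have "Poly_Mapping.lookup ?f \<beta> = 0" for \<beta>
        proof (cases "\<beta> \<in> bounded_monoms n d")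
          case True
          then show ?thesis using zero[of "(\<alpha>, \<beta>)" x] \<alpha> by (simp add: J_def \<mu>_def)
        next
          case False
          then show ?thesis using f(1) by (auto simp: gauge_S_iff in_keys_iff)
        qed
        then have "?f = 0" by (intro poly_mapping_eqI) simp
        then show ?thesis using f(2) coset_zero by simp
      qed
      then have "\<Phi> e s = \<zero>\<^bsub>Q\<^esub>" if "s \<in> carrier Q" for s
        using cartier_maps_eq_zero[OF U_map[OF U] k(2) _ that] by blast
      then have "\<Phi> e = zero_map Q"
        by (intro Q.cartier_maps_eqI[OF U_map[OF U] Q.zero_map_in_cartier_maps]) simp
      then have "\<Phi> i = zero_map Q" for i
        using U_carrier(2)[OF U] by (cases "i = e") (auto simp: degree_part_def)
      then show ?thesis by (auto simp: Q.cartier_algebra_zero)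
    qed
  qed
  moreover have "card J \<le> Suc d ^ n * (p ^ n) ^ e"
  proof -
    have "card J = card ?B * card (bounded_monoms n d)" by (simp add: J_def card_cartesian_product)
    \<comment> \<open>Exponents from 0 to \<open>?q - 1\<close> leave \<open>?q\<close> choices for
      each variable, as \<open>?q\<close> is positive.\<close>
    also have "\<dots> \<le> Suc (?q - 1) ^ n * Suc d ^ n"
      by (intro mult_le_mono card_bounded_monoms_le)
    also have "\<dots> = Suc d ^ n * (p ^ n) ^ e"
      using k(2) by (simp add: mult.commute flip: power_mult)
    finally show ?thesis .
  qed
  ultimately obtain X where X: "X \<subseteq> ?U" "finite X" "card X \<le> Suc d ^ n * (p ^ n) ^ e"
    and gen: "\<And>H. \<zero>\<^bsub>?C\<^esub> \<in> H \<Longrightarrow> X \<subseteq> H \<Longrightarrow> (\<forall>u\<in>H. \<forall>v\<in>X. \<forall>c. comb u v c \<in> H) \<Longrightarrow> ?U \<subseteq> H"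
    by (meson order_trans)
  show ?thesis
    using X m0 by (intro exI[of _ X] conjI allI impI gen) (auto simp: comb_def)
qed

text \<open>A monomial with exponents below \<open>p ^ e\<close> has gauge less than
  \<open>p ^ e\<close>, which contributes at most 1 after division by \<open>p ^ e\<close>. So the
  gauge of its image is at most \<open>K + 1\<close>, independently of \<open>e\<close>.\<close>

lemma gauge_bounded_part:
  assumes p: "p > 0" and \<Psi>: "\<Psi> \<in> degree_part Q D e" "D \<subseteq> carrier (cartier_algebra Q p)"
    and K: "K + 1 \<le> real d"
    and bound: "\<And>r. r \<in> carrier Q \<Longrightarrow> gauge n I (\<Psi> e r) \<le> gauge n I r / ereal (real p ^ e) + ereal K"
  shows "\<Psi> \<in> gauge_part p D d e"
proof -
  have "\<Psi> e (coset (Poly_Mapping.single \<alpha> x)) \<in> gauge_R n I (int d)"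
    if \<alpha>: "\<alpha> \<in> bounded_monoms n (p ^ e - 1)" for \<alpha> x
  proof -
    let ?r = "coset (Poly_Mapping.single \<alpha> x)"
    have r: "?r \<in> carrier Q"
      using \<alpha> coset_closed single_carrier_iff by (auto simp: bounded_monoms_def)
    have \<Psi>r: "\<Psi> e ?r \<in> carrier Q"
      using \<Psi> Q.cartier_algebra_carrierD Q.cartier_maps_closed r by (fastforce simp: degree_part_def)
    have "?r \<in> gauge_R n I (int (p ^ e - 1))"
      using \<alpha> unfolding gauge_R_nat by (intro imageI) (auto simp: gauge_S_iff)
    then have "gauge n I ?r \<le> ereal (real (p ^ e - 1))"
      using gauge_le_iff[OF r] by blast
    also have "\<dots> \<le> ereal (real p ^ e)"
      by (simp flip: of_nat_power)
    \<comment> \<open>The coset may be 0, with gauge minus infinity; the estimate in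
      \<open>ereal\<close> covers this case too.\<close>
    finally have "gauge n I ?r / ereal (real p ^ e) \<le> ereal (real p ^ e) / ereal (real p ^ e)"
      using p by (intro ereal_divide_right_mono) auto
    then have "gauge n I ?r / ereal (real p ^ e) + ereal K \<le> 1 + ereal K"
      using p by (intro add_right_mono) (simp add: one_ereal_def)
    also have "\<dots> \<le> ereal (real d)"
      using K by (simp add: one_ereal_def add.commute)
    finally have "gauge n I (\<Psi> e ?r) \<le> ereal (real d)"
      using bound[OF r] by (rule order_trans[rotated])
    then show ?thesis using gauge_le_iff[OF \<Psi>r] by blast
  qed
  then show ?thesis using \<Psi> by (simp add: gauge_part_def)
qed

end

section \<open>The complexity bound\<close>

theorem theorem2p4:
  fixes n p :: nat
    and I :: "'k::field mpol set"
    and D :: "(nat \<Rightarrow> 'k mpol set \<Rightarrow> 'k mpol set) set"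
  assumes "CHAR('k) = p" and "p > 0"
    and "F_finite_field TYPE('k)"
    and "ideal I (mpol_ring n)"
    and "cartier_subalgebra (mpol_ring n Quot I) p D"
    and "gauge_bounded n I p D"
  shows "cartier_cx (mpol_ring n Quot I) p D \<le> ereal (real p ^ n)"
proof -
  interpret mpol_quotient n I
    using assms(4) by (simp add: mpol_quotient_def)
  let ?C = "cartier_algebra Q p"
  note D = assms(5) and DD = Q.cartier_subalgebra_props[OF assms(5)]
  obtain X and K :: real where X': "\<forall>(e, \<Psi>)\<in>X. 1 \<le> e \<and> \<Psi> \<in> degree_part Q D e"
    and span: "right_span Q p (snd ` X) = positive_part Q D"
    and bound': "\<forall>(e, \<Psi>)\<in>X. \<forall>r\<in>carrier Q.
      gauge n I (\<Psi> e r) \<le> gauge n I r / ereal (real p ^ e) + ereal K"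
    using assms(6) unfolding gauge_bounded_def by (elim exE conjE) (rule that)
  have X: "\<Psi> \<in> degree_part Q D e" if "(e, \<Psi>) \<in> X" for e \<Psi>
    using bspec[OF X' that] by simp
  have bound: "gauge n I (\<Psi> e r) \<le> gauge n I r / ereal (real p ^ e) + ereal K"
    if "(e, \<Psi>) \<in> X" "r \<in> carrier Q" for e \<Psi> r
    using bspec[OF bound' that(1)] that(2) by simp
  \<comment> \<open>One \<open>d\<close> serves all degrees; \<open>nat\<close> gives 0 when
    \<open>K + 1\<close> is negative.\<close>
  define d where "d = nat \<lceil>K + 1\<rceil>"
  have d: "K + 1 \<le> real d" unfolding d_def by linarith
  define N where "N = Suc d ^ n"
  have X_part: "\<Psi> \<in> gauge_part p D d e" if "(e, \<Psi>) \<in> X" for e \<Psi>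
    using that by (intro gauge_bounded_part[OF assms(2) X DD(1) d] bound)
  have zero: "\<zero>\<^bsub>?C\<^esub> = scalar Q \<zero>\<^bsub>Q\<^esub>"
  proof -
    have "(\<lambda>s\<in>carrier Q. \<zero>\<^bsub>Q\<^esub> \<otimes>\<^bsub>Q\<^esub> s) = zero_map Q"
      unfolding zero_map_def by (rule restrict_ext) simp
    then show ?thesis
      by (simp add: Q.cartier_algebra_zero scalar_def homog_def)
  qed
  \<comment> \<open>Generating sets for all degrees are chosen at once, so that the sets in degrees
    up to \<open>e\<close> can be united.\<close>
  have "\<exists>Y. \<forall>e. Y e \<subseteq> gauge_part p D d e \<and> finite (Y e) \<and> card (Y e) \<le> Suc d ^ n * (p ^ n) ^ e \<and>
    (\<forall>H. \<zero>\<^bsub>?C\<^esub> \<in> H \<longrightarrow> Y e \<subseteq> H \<longrightarrow>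
      (\<forall>\<Phi>\<in>H. \<forall>\<Psi>\<in>Y e. \<forall>r\<in>carrier Q. \<Phi> \<oplus>\<^bsub>?C\<^esub> (\<Psi> \<otimes>\<^bsub>?C\<^esub> scalar Q r) \<in> H) \<longrightarrow>
      gauge_part p D d e \<subseteq> H)" (is "\<exists>Y. ?P Y")
    by (rule choice, rule allI, rule gauge_part_generators[OF assms(1-3) D])
  then obtain Y where Y: "?P Y" ..
  have Y_part: "Y e \<subseteq> gauge_part p D d e" and Y_fin: "finite (Y e)"
    and Y_card: "card (Y e) \<le> N * (p ^ n) ^ e" for e
    using spec[OF Y, of e] by (simp_all add: N_def)
  have gen: "gauge_part p D d e \<subseteq> H"
    if "\<zero>\<^bsub>?C\<^esub> \<in> H" "Y e \<subseteq> H"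
      "\<forall>\<Phi>\<in>H. \<forall>\<Psi>\<in>Y e. \<forall>r\<in>carrier Q. \<Phi> \<oplus>\<^bsub>?C\<^esub> (\<Psi> \<otimes>\<^bsub>?C\<^esub> scalar Q r) \<in> H" for e H
    using spec[OF Y, of e] that by simp
  have Y_deg: "Y e \<subseteq> degree_part Q D e" for e
    using Y_part by (auto simp: gauge_part_def)
  \<comment> \<open>The generated ring contains all scalars and is closed under sums and products.
    It therefore contains the gauge part, hence the given generators of degree \<open>e\<close>,
    hence by the right span all of degree \<open>e\<close>.\<close>
  have deg: "degree_part Q D e \<subseteq> generate_ring ?C (degree_part Q D 0 \<union> Y e)" if "e > 0" for e
  proof -
    let ?H = "generate_ring ?C (degree_part Q D 0 \<union> Y e)"
    have scalar: "scalar Q r \<in> ?H" if "r \<in> carrier Q" for r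
      using that DD(6) by (intro generate_ring.incl) auto
    then have z: "\<zero>\<^bsub>?C\<^esub> \<in> ?H" unfolding zero by simp
    have part: "gauge_part p D d e \<subseteq> ?H"
      using scalar by (intro gen z) (auto intro: generate_ring.intros)
    have generators: "\<Psi> \<in> ?H" if "(e, \<Psi>) \<in> X" for \<Psi>
      by (rule subsetD[OF part X_part[OF that]])
    show ?thesis
      by (rule Q.degree_part_subset_of_right_span[OF D X span that z])
        (blast intro: generate_ring.eng_add generate_ring.eng_mult scalar generators)+
  qed
  have "cartier_k Q p D (int e) \<le> enat (N * e * (p ^ n) ^ e)" for e
  proof -
    have "cartier_k Q p D (int e) \<le> enat (\<Sum>i=1..e. card (Y i))"
      by (rule Q.cartier_k_le[OF D Y_fin Y_deg deg]) simp
    \<comment> \<open>Each degree up to \<open>e\<close> is bounded by the term for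
      \<open>e\<close>, which produces the linear factor \<open>e\<close>.\<close>
    moreover have "(\<Sum>i=1..e. card (Y i)) \<le> (\<Sum>i=1..e. N * (p ^ n) ^ e)"
    proof (rule sum_mono)
      fix i assume "i \<in> {1..e}"
      then have "(p ^ n) ^ i \<le> (p ^ n) ^ e" using assms(2) by (intro power_increasing) auto
      then show "card (Y i) \<le> N * (p ^ n) ^ e"
        using Y_card[of i] by (meson mult_le_mono2 order_trans)
    qed
    ultimately show ?thesis
      by (simp add: mult.assoc mult.left_commute) (meson enat_ord_simps(1) order_trans)
  qed
  then have "cartier_cx Q p D \<le> ereal (real (p ^ n))"
    using assms(2) by (intro cartier_cx_le[OF Q.cartier_k_minus_one[OF D]]) auto
  then show ?thesis by simp
qed

end
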